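(* Let $\mathsf{A}$ be an abelian category and let $\mathsf{V}$ be a special preenveloping subcategory of $\mathsf{A}$ closed under direct summands. Then for each object $N$ in $\mathsf{A}$ the following statements are equivalent: (i) $\mathsf{V}\text{-}\mathrm{id}_{\mathsf{A}}N<\infty$. (ii) $\check{\operatorname{Ext}}{}^{n}_{\mathsf{V}}(N,-)=0=\check{\operatorname{Ext}}{}^{n}_{\mathsf{V}}(-,N)$ for all $n\in\mathbb{Z}$. (iii) $\check{\operatorname{Ext}}{}^{0}_{\mathsf{V}}(N,N)=0$.
   Context: "Subcategory" means a full additive subcategory closed under isomorphisms; Ext is Yoneda Ext. ${}^{\perp}\mathsf{V}=\{M\mid\operatorname{Ext}^1_{\mathsf{A}}(M,V)=0\ \forall V\in\mathsf{V}\}$. A special $\mathsf{V}$-preenvelope of $M$ is an exact sequence $0\to M\to V\to C\to0$ with $V\in\mathsf{V}$, $C\in{}^{\perp}\mathsf{V}$; $\mathsf{V}$ is special preenveloping if every object has one. A proper $\mathsf{V}$-coresolution $M\xrightarrow{\simeq}I$ is a complex $I$ of objects in $\mathsf{V}$ with $I^{-n}=0=\mathrm{H}^n(I)$ for $n>0$ and $\mathrm{H}^0(I)\cong M$, such that $0\to M\to I^0\to I^1\to\cdots$ stays exact under $\operatorname{Hom}_{\mathsf{A}}(-,V)$ for all $V\in\mathsf{V}$. It is special if $\operatorname{Ker}(I^i\to I^{i+1})\in{}^{\perp}\mathsf{V}$ for $i\ge1$; special ones exist for all objects. $\mathsf{\Theta}^i_{\mathsf{V}}M$ is $\operatorname{Ker}(I^i\to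 I^{i+1})$ for a chosen special proper $\mathsf{V}$-coresolution $I$ of $M$; $\mathsf{\Theta}^0_{\mathsf{V}}M=M$, $\mathsf{\Theta}_{\mathsf{V}}=\mathsf{\Theta}^1_{\mathsf{V}}$. The $\mathsf{V}$-injective dimension is $\mathsf{V}\text{-}\mathrm{id}_{\mathsf{A}}N=\inf\{\sup\{n\ge0\mid I^n\ne0\}\mid N\xrightarrow{\simeq}I\text{ a proper }\mathsf{V}\text{-coresolution}\}$. Complete cohomology. $\overline{\operatorname{Hom}}{}^{\mathsf{V}}_{\mathsf{A}}(M,N)$ is $\operatorname{Hom}_{\mathsf{A}}(M,N)$ modulo the subgroup of morphisms factoring through an object of $\mathsf{V}$. Take special $\mathsf{V}$-preenvelopes $0\to M\to I^0\to\mathsf{\Theta}_{\mathsf{V}}M\to0$ and $0\to N\to J^0\to\mathsf{\Theta}_{\mathsf{V}}N\to0$. The connecting morphism $\operatorname{Hom}_{\mathsf{A}}(M,N)\to\operatorname{Ext}^1_{\mathsf{A}}(\mathsf{\Theta}_{\mathsf{V}}M,N)$ induces a monomorphism $\overline{\delta}\colon\overline{\operatorname{Hom}}{}^{\mathsf{V}}_{\mathsf{A}}(M,N)\to\operatorname{Ext}^1_{\mathsf{A}}(\mathsf{\Theta}_{\mathsf{V}}M,N)$; the connecting morphism $\partial\colon\operatorname{Hom}_{\mathsf{A}}(\mathsf{\Theta}_{\mathsf{V}}M,\mathsf{\Theta}_{\mathsf{V}}N)\to\operatorname{Ext}^1_{\mathsf{A}}(\mathsf{\Theta}_{\mathsf{V}}M,N)$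 is epi, and there is a unique $\beta\colon\operatorname{Ext}^1_{\mathsf{A}}(\mathsf{\Theta}_{\mathsf{V}}M,N)\to\overline{\operatorname{Hom}}{}^{\mathsf{V}}_{\mathsf{A}}(\mathsf{\Theta}_{\mathsf{V}}M,\mathsf{\Theta}_{\mathsf{V}}N)$ with $\beta\partial$ the canonical projection. Put $\Delta=\beta\overline{\delta}\colon\overline{\operatorname{Hom}}{}^{\mathsf{V}}_{\mathsf{A}}(M,N)\to\overline{\operatorname{Hom}}{}^{\mathsf{V}}_{\mathsf{A}}(\mathsf{\Theta}_{\mathsf{V}}M,\mathsf{\Theta}_{\mathsf{V}}N)$. Iterating yields, for $n\in\mathbb{Z}$, a direct system over the integers $i\ge\max\{0,-n\}$ and $$\check{\operatorname{Ext}}{}^{n}_{\mathsf{V}}(M,N)=\operatorname{colim}_i\overline{\operatorname{Hom}}{}^{\mathsf{V}}_{\mathsf{A}}(\mathsf{\Theta}^i_{\mathsf{V}}M,\mathsf{\Theta}^{i+n}_{\mathsf{V}}N).$$ *)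

theory Defs
  imports "HOL-Algebra.Elementary_Groups" "HOL-Library.Extended_Real"
begin

section \<open>Abelian categories\<close>

text \<open>Categories with carrier sets of objects and arrows, and an addition on parallel arrows.
  All operations are only meaningful on the carriers.\<close>

record ('o, 'm) cat =
  Ob :: "'o set"
  Arr :: "'m set"
  Dom :: "'m \<Rightarrow> 'o"
  Cod :: "'m \<Rightarrow> 'o"
  Ide :: "'o \<Rightarrow> 'm"
  Comp :: "'m \<Rightarrow> 'm \<Rightarrow> 'm"  (infixl \<open>\<cdot>\<index>\<close> 70)
  Plus :: "'m \<Rightarrow> 'm \<Rightarrow> 'm"
  Null :: "'o \<Rightarrow> 'o \<Rightarrow> 'm"

definition Hom :: "('o, 'm) cat \<Rightarrow> 'o \<Rightarrow> 'o \<Rightarrow> 'm set" where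
  "Hom C A B = {f \<in> Arr C. Dom C f = A \<and> Cod C f = B}"

definition Hom_group :: "('o, 'm) cat \<Rightarrow> 'o \<Rightarrow> 'o \<Rightarrow> 'm monoid" where
  "Hom_group C A B = \<lparr>carrier = Hom C A B, mult = Plus C, one = Null C A B\<rparr>"

locale category =
  fixes C :: "('o, 'm) cat" (structure)
  assumes Dom_closed: "f \<in> Arr C \<Longrightarrow> Dom C f \<in> Ob C"
    and Cod_closed: "f \<in> Arr C \<Longrightarrow> Cod C f \<in> Ob C"
    and Ide_closed: "A \<in> Ob C \<Longrightarrow> Ide C A \<in> Hom C A A"
    and Comp_closed: "f \<in> Hom C A B \<Longrightarrow> g \<in> Hom C B D \<Longrightarrow> g \<cdot> f \<in> Hom C A D"
    and Comp_assoc: "f \<in> Hom C A B \<Longrightarrow> g \<in> Hom C B D \<Longrightarrow> h \<in> Hom C D E \<Longrightarrow>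
      (h \<cdot> g) \<cdot> f = h \<cdot> (g \<cdot> f)"
    and Comp_Ide_right: "f \<in> Hom C A B \<Longrightarrow> f \<cdot> Ide C A = f"
    and Comp_Ide_left: "f \<in> Hom C A B \<Longrightarrow> Ide C B \<cdot> f = f"

locale preadditive_category = category +
  assumes Hom_comm_group: "A \<in> Ob C \<Longrightarrow> B \<in> Ob C \<Longrightarrow> comm_group (Hom_group C A B)"
    and Comp_Plus_right: "f \<in> Hom C A B \<Longrightarrow> f' \<in> Hom C A B \<Longrightarrow> g \<in> Hom C B D \<Longrightarrow>
      g \<cdot> Plus C f f' = Plus C (g \<cdot> f) (g \<cdot> f')"
    and Comp_Plus_left: "f \<in> Hom C A B \<Longrightarrow> g \<in> Hom C B D \<Longrightarrow> g' \<in> Hom C B D \<Longrightarrow>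
      Plus C g g' \<cdot> f = Plus C (g \<cdot> f) (g' \<cdot> f)"

definition is_mono :: "('o, 'm) cat \<Rightarrow> 'm \<Rightarrow> bool" where
  "is_mono C f \<longleftrightarrow> f \<in> Arr C \<and>
     (\<forall>A \<in> Ob C. \<forall>g \<in> Hom C A (Dom C f). \<forall>h \<in> Hom C A (Dom C f).
        f \<cdot>\<^bsub>C\<^esub> g = f \<cdot>\<^bsub>C\<^esub> h \<longrightarrow> g = h)"

definition is_epi :: "('o, 'm) cat \<Rightarrow> 'm \<Rightarrow> bool" where
  "is_epi C f \<longleftrightarrow> f \<in> Arr C \<and>
     (\<forall>B \<in> Ob C. \<forall>g \<in> Hom C (Cod C f) B. \<forall>h \<in> Hom C (Cod C f) B.
        g \<cdot>\<^bsub>C\<^esub> f = h \<cdot>\<^bsub>C\<^esub> f \<longrightarrow> g = h)"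

definition is_iso :: "('o, 'm) cat \<Rightarrow> 'm \<Rightarrow> bool" where
  "is_iso C f \<longleftrightarrow> f \<in> Arr C \<and>
     (\<exists>g \<in> Hom C (Cod C f) (Dom C f).
        g \<cdot>\<^bsub>C\<^esub> f = Ide C (Dom C f) \<and> f \<cdot>\<^bsub>C\<^esub> g = Ide C (Cod C f))"

definition isomorphic :: "('o, 'm) cat \<Rightarrow> 'o \<Rightarrow> 'o \<Rightarrow> bool" where
  "isomorphic C A B \<longleftrightarrow> (\<exists>f \<in> Hom C A B. is_iso C f)"

definition is_zero_object :: "('o, 'm) cat \<Rightarrow> 'o \<Rightarrow> bool" where
  "is_zero_object C Z \<longleftrightarrow> Z \<in> Ob C \<and>
     (\<forall>A \<in> Ob C. (\<exists>!f. f \<in> Hom C A Z) \<and> (\<exists>!f. f \<in> Hom C Z A))"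

definition is_biproduct ::
  "('o, 'm) cat \<Rightarrow> 'o \<Rightarrow> 'o \<Rightarrow> 'o \<Rightarrow> 'm \<Rightarrow> 'm \<Rightarrow> 'm \<Rightarrow> 'm \<Rightarrow> bool" where
  "is_biproduct C A B S i j p q \<longleftrightarrow>
     i \<in> Hom C A S \<and> j \<in> Hom C B S \<and> p \<in> Hom C S A \<and> q \<in> Hom C S B \<and>
     p \<cdot>\<^bsub>C\<^esub> i = Ide C A \<and> q \<cdot>\<^bsub>C\<^esub> j = Ide C B \<and>
     q \<cdot>\<^bsub>C\<^esub> i = Null C A B \<and> p \<cdot>\<^bsub>C\<^esub> j = Null C B A \<and>
     Plus C (i \<cdot>\<^bsub>C\<^esub> p) (j \<cdot>\<^bsub>C\<^esub> q) = Ide C S"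

definition is_kernel :: "('o, 'm) cat \<Rightarrow> 'm \<Rightarrow> 'm \<Rightarrow> bool" where
  "is_kernel C k f \<longleftrightarrow> f \<in> Arr C \<and> k \<in> Arr C \<and> Cod C k = Dom C f \<and>
     f \<cdot>\<^bsub>C\<^esub> k = Null C (Dom C k) (Cod C f) \<and>
     (\<forall>A \<in> Ob C. \<forall>h \<in> Hom C A (Dom C f). f \<cdot>\<^bsub>C\<^esub> h = Null C A (Cod C f) \<longrightarrow>
        (\<exists>!u. u \<in> Hom C A (Dom C k) \<and> k \<cdot>\<^bsub>C\<^esub> u = h))"

definition is_cokernel :: "('o, 'm) cat \<Rightarrow> 'm \<Rightarrow> 'm \<Rightarrow> bool" where
  "is_cokernel C c f \<longleftrightarrow> f \<in> Arr C \<and> c \<in> Arr C \<and> Dom C c = Cod C f \<and>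
     c \<cdot>\<^bsub>C\<^esub> f = Null C (Dom C f) (Cod C c) \<and>
     (\<forall>B \<in> Ob C. \<forall>h \<in> Hom C (Cod C f) B. h \<cdot>\<^bsub>C\<^esub> f = Null C (Dom C f) B \<longrightarrow>
        (\<exists>!u. u \<in> Hom C (Cod C c) B \<and> u \<cdot>\<^bsub>C\<^esub> c = h))"

locale abelian_category = preadditive_category +
  assumes zero_object_exists: "\<exists>Z. is_zero_object C Z"
    and biproduct_exists: "A \<in> Ob C \<Longrightarrow> B \<in> Ob C \<Longrightarrow> \<exists>S i j p q. is_biproduct C A B S i j p q"
    and kernel_exists: "f \<in> Arr C \<Longrightarrow> \<exists>k. is_kernel C k f"
    and cokernel_exists: "f \<in> Arr C \<Longrightarrow> \<exists>c. is_cokernel C c f"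
    and mono_normal: "is_mono C f \<Longrightarrow> \<exists>g. is_kernel C f g"
    and epi_normal: "is_epi C f \<Longrightarrow> \<exists>g. is_cokernel C f g"

text \<open>The kernel of \<open>f\<close> is an arrow into \<open>Dom C f\<close>; its underlying object is \<open>Dom C (ker C f)\<close>.\<close>

definition ker :: "('o, 'm) cat \<Rightarrow> 'm \<Rightarrow> 'm" where
  "ker C f = (SOME k. is_kernel C k f)"

definition coker :: "('o, 'm) cat \<Rightarrow> 'm \<Rightarrow> 'm" where
  "coker C f = (SOME c. is_cokernel C c f)"

definition image_arr :: "('o, 'm) cat \<Rightarrow> 'm \<Rightarrow> 'm" where
  "image_arr C f = ker C (coker C f)"

definition exact_at :: "('o, 'm) cat \<Rightarrow> 'm \<Rightarrow> 'm \<Rightarrow> bool" where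
  "exact_at C f g \<longleftrightarrow> f \<in> Arr C \<and> g \<in> Arr C \<and> Cod C f = Dom C g \<and>
     is_kernel C (image_arr C f) g"

definition short_exact :: "('o, 'm) cat \<Rightarrow> 'm \<Rightarrow> 'm \<Rightarrow> bool" where
  "short_exact C i p \<longleftrightarrow> is_kernel C i p \<and> is_cokernel C p i"


section \<open>Yoneda Ext\<close>

text \<open>An extension \<open>0 \<rightarrow> A \<rightarrow> E \<rightarrow> X \<rightarrow> 0\<close> is the pair of its two arrows, and the elements of
  \<open>Ext1 C X A\<close> are equivalence classes of such pairs. Only the underlying pointed set is
  introduced: \<open>Ext\<^sup>1 = 0\<close> and the connecting maps below do not refer to the Baer sum.\<close>

definition extensions :: "('o, 'm) cat \<Rightarrow> 'o \<Rightarrow> 'o \<Rightarrow> ('m \<times> 'm) set" where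
  "extensions C X A = {(i, p). short_exact C i p \<and> Dom C i = A \<and> Cod C p = X}"

definition ext_rel :: "('o, 'm) cat \<Rightarrow> 'o \<Rightarrow> 'o \<Rightarrow> (('m \<times> 'm) \<times> ('m \<times> 'm)) set" where
  "ext_rel C X A = {((i, p), (i', p')). (i, p) \<in> extensions C X A \<and> (i', p') \<in> extensions C X A \<and>
     (\<exists>\<phi> \<in> Hom C (Cod C i) (Cod C i'). is_iso C \<phi> \<and> \<phi> \<cdot>\<^bsub>C\<^esub> i = i' \<and> p' \<cdot>\<^bsub>C\<^esub> \<phi> = p)}"

definition Ext1 :: "('o, 'm) cat \<Rightarrow> 'o \<Rightarrow> 'o \<Rightarrow> ('m \<times> 'm) set set" where
  "Ext1 C X A = extensions C X A // ext_rel C X A"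

definition ext_class :: "('o, 'm) cat \<Rightarrow> ('m \<times> 'm) \<Rightarrow> ('m \<times> 'm) set" where
  "ext_class C e = ext_rel C (Cod C (snd e)) (Dom C (fst e)) `` {e}"

text \<open>The class of \<open>0 \<rightarrow> A \<rightarrow> A \<oplus> X \<rightarrow> X \<rightarrow> 0\<close>.\<close>

definition Ext1_zero :: "('o, 'm) cat \<Rightarrow> 'o \<Rightarrow> 'o \<Rightarrow> ('m \<times> 'm) set" where
  "Ext1_zero C X A = ext_class C (SOME (i, q). \<exists>S j p. is_biproduct C A X S i j p q)"

text \<open>The actions of arrows on extension classes, following Mac Lane: for \<open>f : A \<rightarrow> A'\<close> the class
  \<open>f e\<close> consists of the extensions of \<open>X\<close> by \<open>A'\<close> that receive a morphism
  \<open>(f, \<phi>, 1)\<close> from a member of \<open>e\<close> (the lower row of the pushout diagram); for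
  \<open>g : X' \<rightarrow> X\<close> the class \<open>e g\<close> consists of the extensions of \<open>X'\<close> by \<open>A\<close> with a morphism
  \<open>(1, \<phi>, g)\<close> to a member of \<open>e\<close> (the upper row of the pullback diagram).\<close>

definition Ext1_push :: "('o, 'm) cat \<Rightarrow> 'o \<Rightarrow> 'm \<Rightarrow> ('m \<times> 'm) set \<Rightarrow> ('m \<times> 'm) set" where
  "Ext1_push C X f e = {(i', p') \<in> extensions C X (Cod C f).
     \<exists>(i, p) \<in> e. \<exists>\<phi> \<in> Hom C (Cod C i) (Cod C i').
       \<phi> \<cdot>\<^bsub>C\<^esub> i = i' \<cdot>\<^bsub>C\<^esub> f \<and> p' \<cdot>\<^bsub>C\<^esub> \<phi> = p}"

definition Ext1_pull :: "('o, 'm) cat \<Rightarrow> 'o \<Rightarrow> 'm \<Rightarrow> ('m \<times> 'm) set \<Rightarrow> ('m \<times> 'm) set" where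
  "Ext1_pull C A g e = {(i', p') \<in> extensions C (Dom C g) A.
     \<exists>(i, p) \<in> e. \<exists>\<phi> \<in> Hom C (Cod C i') (Cod C i).
       \<phi> \<cdot>\<^bsub>C\<^esub> i' = i \<and> p \<cdot>\<^bsub>C\<^esub> \<phi> = g \<cdot>\<^bsub>C\<^esub> p'}"


section \<open>Special preenveloping subcategories\<close>

text \<open>A full subcategory is given by its set of objects.\<close>

definition additive_subcategory :: "('o, 'm) cat \<Rightarrow> 'o set \<Rightarrow> bool" where
  "additive_subcategory C V \<longleftrightarrow> V \<subseteq> Ob C \<and>
     (\<forall>A \<in> V. \<forall>B \<in> Ob C. isomorphic C A B \<longrightarrow> B \<in> V) \<and>
     (\<exists>Z \<in> V. is_zero_object C Z) \<and>
     (\<forall>A \<in> V. \<forall>B \<in> V. \<exists>S \<in> V. \<exists>i j p q. is_biproduct C A B S i j p q)"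

definition closed_under_summands :: "('o, 'm) cat \<Rightarrow> 'o set \<Rightarrow> bool" where
  "closed_under_summands C V \<longleftrightarrow>
     (\<forall>A \<in> Ob C. \<forall>B \<in> Ob C. \<forall>S \<in> V. \<forall>i j p q. is_biproduct C A B S i j p q \<longrightarrow> A \<in> V)"

definition left_perp :: "('o, 'm) cat \<Rightarrow> 'o set \<Rightarrow> 'o set" where
  "left_perp C V = {M \<in> Ob C. \<forall>W \<in> V. Ext1 C M W = {Ext1_zero C M W}}"

definition special_preenvelope :: "('o, 'm) cat \<Rightarrow> 'o set \<Rightarrow> 'o \<Rightarrow> 'm \<Rightarrow> 'm \<Rightarrow> bool" where
  "special_preenvelope C V M i p \<longleftrightarrow>
     short_exact C i p \<and> Dom C i = M \<and> Cod C i \<in> V \<and> Cod C p \<in> left_perp C V"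

definition special_preenveloping :: "('o, 'm) cat \<Rightarrow> 'o set \<Rightarrow> bool" where
  "special_preenveloping C V \<longleftrightarrow> (\<forall>M \<in> Ob C. \<exists>i p. special_preenvelope C V M i p)"


section \<open>Proper coresolutions\<close>

text \<open>A complex that vanishes in negative degrees, together with an augmentation
  \<open>M \<rightarrow> I\<^sup>0\<close> that identifies \<open>M\<close> with \<open>H\<^sup>0(I)\<close>.\<close>

record ('o, 'm) coresolution =
  Term :: "nat \<Rightarrow> 'o"
  Diff :: "nat \<Rightarrow> 'm"
  Aug :: "'m"

definition proper_coresolution ::
  "('o, 'm) cat \<Rightarrow> 'o set \<Rightarrow> 'o \<Rightarrow> ('o, 'm) coresolution \<Rightarrow> bool" where
  "proper_coresolution C V M I \<longleftrightarrow>
     (\<forall>n. Term I n \<in> V) \<and>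
     (\<forall>n. Diff I n \<in> Hom C (Term I n) (Term I (Suc n))) \<and>
     Aug I \<in> Hom C M (Term I 0) \<and>
     is_kernel C (Aug I) (Diff I 0) \<and>
     (\<forall>n. exact_at C (Diff I n) (Diff I (Suc n))) \<and>
     (\<forall>W \<in> V.
        (\<lambda>g. g \<cdot>\<^bsub>C\<^esub> Aug I) ` Hom C (Term I 0) W = Hom C M W \<and>
        (\<lambda>g. g \<cdot>\<^bsub>C\<^esub> Diff I 0) ` Hom C (Term I 1) W =
          {f \<in> Hom C (Term I 0) W. f \<cdot>\<^bsub>C\<^esub> Aug I = Null C M W} \<and>
        (\<forall>n. (\<lambda>g. g \<cdot>\<^bsub>C\<^esub> Diff I (Suc n)) ` Hom C (Term I (Suc (Suc n))) W =
          {f \<in> Hom C (Term I (Suc n)) W. f \<cdot>\<^bsub>C\<^esub> Diff I n = Null C (Term I n) W}))"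

definition special_proper_coresolution ::
  "('o, 'm) cat \<Rightarrow> 'o set \<Rightarrow> 'o \<Rightarrow> ('o, 'm) coresolution \<Rightarrow> bool" where
  "special_proper_coresolution C V M I \<longleftrightarrow> proper_coresolution C V M I \<and>
     (\<forall>i\<ge>1. Dom C (ker C (Diff I i)) \<in> left_perp C V)"

text \<open>With values in \<^typ>\<open>ereal\<close>, so that the dimension of a zero object is \<open>-\<infinity>\<close> and
  the infimum over the empty set is \<open>\<infinity>\<close>.\<close>

definition V_id :: "('o, 'm) cat \<Rightarrow> 'o set \<Rightarrow> 'o \<Rightarrow> ereal" where
  "V_id C V N = (INF I \<in> {I. proper_coresolution C V N I}.
     SUP n \<in> {n. \<not> is_zero_object C (Term I n)}. ereal (real n))"

text \<open>For a coresolution \<open>I\<close> of \<open>M\<close>: the object \<open>\<Theta>\<^sup>iM\<close> and the extension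
  \<open>0 \<rightarrow> \<Theta>\<^sup>iM \<rightarrow> I\<^sup>i \<rightarrow> \<Theta>\<^sup>i\<^sup>+\<^sup>1M \<rightarrow> 0\<close>, whose second arrow is the corestriction of the
  differential.\<close>

definition theta :: "('o, 'm) cat \<Rightarrow> 'o \<Rightarrow> ('o, 'm) coresolution \<Rightarrow> nat \<Rightarrow> 'o" where
  "theta C M I i = (if i = 0 then M else Dom C (ker C (Diff I i)))"

definition theta_in :: "('o, 'm) cat \<Rightarrow> ('o, 'm) coresolution \<Rightarrow> nat \<Rightarrow> 'm" where
  "theta_in C I i = (if i = 0 then Aug I else ker C (Diff I i))"

definition theta_out :: "('o, 'm) cat \<Rightarrow> ('o, 'm) coresolution \<Rightarrow> nat \<Rightarrow> 'm" where
  "theta_out C I i = (THE u. u \<in> Hom C (Term I i) (Dom C (ker C (Diff I (Suc i)))) \<and>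
     ker C (Diff I (Suc i)) \<cdot>\<^bsub>C\<^esub> u = Diff I i)"

definition theta_ext :: "('o, 'm) cat \<Rightarrow> ('o, 'm) coresolution \<Rightarrow> nat \<Rightarrow> 'm \<times> 'm" where
  "theta_ext C I i = (theta_in C I i, theta_out C I i)"


section \<open>Complete cohomology\<close>

definition factoring :: "('o, 'm) cat \<Rightarrow> 'o set \<Rightarrow> 'o \<Rightarrow> 'o \<Rightarrow> 'm set" where
  "factoring C V A B =
     {f \<in> Hom C A B. \<exists>W \<in> V. \<exists>g \<in> Hom C A W. \<exists>h \<in> Hom C W B. f = h \<cdot>\<^bsub>C\<^esub> g}"

definition Hom_bar :: "('o, 'm) cat \<Rightarrow> 'o set \<Rightarrow> 'o \<Rightarrow> 'o \<Rightarrow> 'm set monoid" where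
  "Hom_bar C V A B = Hom_group C A B Mod factoring C V A B"

definition Hom_proj :: "('o, 'm) cat \<Rightarrow> 'o set \<Rightarrow> 'o \<Rightarrow> 'o \<Rightarrow> 'm \<Rightarrow> 'm set" where
  "Hom_proj C V A B f = factoring C V A B #>\<^bsub>Hom_group C A B\<^esub> f"

text \<open>In the following, \<open>e\<close> and \<open>e'\<close> are the extensions \<open>0 \<rightarrow> M \<rightarrow> I \<rightarrow> \<Theta>M \<rightarrow> 0\<close> and
  \<open>0 \<rightarrow> N \<rightarrow> J \<rightarrow> \<Theta>N \<rightarrow> 0\<close> given by special preenvelopes. The connecting maps send
  \<open>f : M \<rightarrow> N\<close> to \<open>f e\<close> and \<open>g : \<Theta>M \<rightarrow> \<Theta>N\<close> to \<open>e' g\<close>.\<close>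

definition delta :: "('o, 'm) cat \<Rightarrow> 'm \<times> 'm \<Rightarrow> 'm \<Rightarrow> ('m \<times> 'm) set" where
  "delta C e f = Ext1_push C (Cod C (snd e)) f (ext_class C e)"

definition delta_bar :: "('o, 'm) cat \<Rightarrow> 'm \<times> 'm \<Rightarrow> 'm set \<Rightarrow> ('m \<times> 'm) set" where
  "delta_bar C e c = the_elem (delta C e ` c)"

definition partial :: "('o, 'm) cat \<Rightarrow> 'm \<times> 'm \<Rightarrow> 'm \<Rightarrow> ('m \<times> 'm) set" where
  "partial C e' g = Ext1_pull C (Dom C (fst e')) g (ext_class C e')"

text \<open>The unique map whose composite with \<open>partial C e'\<close> is the projection onto \<open>Hom_bar\<close>: its
  value at \<open>x\<close> is the class of any preimage of \<open>x\<close>.\<close>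

definition beta ::
  "('o, 'm) cat \<Rightarrow> 'o set \<Rightarrow> 'm \<times> 'm \<Rightarrow> 'm \<times> 'm \<Rightarrow> ('m \<times> 'm) set \<Rightarrow> 'm set" where
  "beta C V e e' x = the_elem (Hom_proj C V (Cod C (snd e)) (Cod C (snd e')) `
     {g \<in> Hom C (Cod C (snd e)) (Cod C (snd e')). partial C e' g = x})"

definition Delta ::
  "('o, 'm) cat \<Rightarrow> 'o set \<Rightarrow> 'm \<times> 'm \<Rightarrow> 'm \<times> 'm \<Rightarrow> 'm set \<Rightarrow> 'm set" where
  "Delta C V e e' c = beta C V e e' (delta_bar C e c)"

text \<open>Colimit of the direct system \<open>G k \<rightarrow> G (k + 1) \<rightarrow> \<dots>\<close> with transition maps
  \<open>t i : G i \<rightarrow> G (i + 1)\<close>; the composite \<open>G i \<rightarrow> G l\<close> is \<open>fold t [i..<l]\<close>.\<close>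

definition colim_rel ::
  "nat \<Rightarrow> (nat \<Rightarrow> 'a monoid) \<Rightarrow> (nat \<Rightarrow> 'a \<Rightarrow> 'a) \<Rightarrow> ((nat \<times> 'a) \<times> (nat \<times> 'a)) set" where
  "colim_rel k G t = {((i, x), (j, y)). k \<le> i \<and> k \<le> j \<and> x \<in> carrier (G i) \<and> y \<in> carrier (G j) \<and>
     (\<exists>l. i \<le> l \<and> j \<le> l \<and> fold t [i..<l] x = fold t [j..<l] y)}"

definition colim ::
  "nat \<Rightarrow> (nat \<Rightarrow> 'a monoid) \<Rightarrow> (nat \<Rightarrow> 'a \<Rightarrow> 'a) \<Rightarrow> (nat \<times> 'a) set monoid" where
  "colim k G t =
     \<lparr>carrier = (SIGMA i:{k..}. carrier (G i)) // colim_rel k G t,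
      mult = (\<lambda>X Y. \<Union>(i, x) \<in> X. \<Union>(j, y) \<in> Y. colim_rel k G t ``
        {(max i j, fold t [i..<max i j] x \<otimes>\<^bsub>G (max i j)\<^esub> fold t [j..<max i j] y)}),
      one = colim_rel k G t `` {(k, \<one>\<^bsub>G k\<^esub>)}\<rparr>"

text \<open>\<open>R\<close> is the choice of a special proper coresolution of every object. The system starts at
  \<open>nat (- n)\<close>, which is \<open>max 0 (- n)\<close>.\<close>

definition complete_Ext ::
  "('o, 'm) cat \<Rightarrow> 'o set \<Rightarrow> ('o \<Rightarrow> ('o, 'm) coresolution) \<Rightarrow> int \<Rightarrow> 'o \<Rightarrow> 'o \<Rightarrow>
     (nat \<times> 'm set) set monoid" where
  "complete_Ext C V R n M N = colim (nat (- n))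
     (\<lambda>i. Hom_bar C V (theta C M (R M) i) (theta C N (R N) (nat (int i + n))))
     (\<lambda>i. Delta C V (theta_ext C (R M) i) (theta_ext C (R N) (nat (int i + n))))"

end

theory Submission
  imports Defs
begin

text \<open>
  A morphism \<open>(f, \<phi>, g)\<close> from \<open>0 \<rightarrow> M \<rightarrow> I \<rightarrow> \<Theta>M \<rightarrow> 0\<close> to \<open>0 \<rightarrow> N \<rightarrow> J \<rightarrow> \<Theta>N \<rightarrow> 0\<close> gives
  \<open>f e = e' g\<close> in \<open>Ext\<^sup>1\<close>, hence \<open>\<Delta>[f] = [g]\<close>; in particular \<open>\<Delta>\<close> sends the class of the
  identity to the class of the identity. So if the colimit for \<open>N, N\<close> vanishes, the identity of some
  \<open>\<Theta>\<^sup>lN\<close> factors through \<open>V\<close>, thus \<open>\<Theta>\<^sup>lN \<in> V\<close> as a direct summand, and the coresolution of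
  \<open>N\<close> can be truncated there. Conversely, comparing a finite proper coresolution of \<open>N\<close> with the
  chosen one shows that modulo \<open>V\<close> the object \<open>\<Theta>\<^sup>iN\<close> is a retract of the \<open>i\<close>-th cosyzygy of the
  finite one, which is zero for large \<open>i\<close>. Then every morphism from or to \<open>\<Theta>\<^sup>iN\<close> factors through
  \<open>V\<close>, and the direct systems are eventually zero.
\<close>

section \<open>Preadditive categories\<close>

text \<open>Two choices are hidden in the uses of \<open>the_elem\<close> behind
  \<open>Delta\<close>: a representative of a class modulo V, and a preimage under
  \<open>partial\<close>. Both must be shown harmless before \<open>Delta\<close> can be evaluated
  at all. Changing an arrow by one that factors through V leaves its pushout class unchanged,
  because arrows into V extend along the first arrow of the extension. Two arrows with a common
  pullback extension differ by an arrow through the middle term, which lies in V. As the elements of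
  \<open>Ext1\<close> are plain sets of extensions, a pushout class and a pullback class are
  compared member by member, and a member must be exhibited before preimages can be compared.

  The extension property comes from the Hom-exactness of proper coresolutions. It has to be carried
  from the complex to its short exact pieces, and back again for the truncated coresolution. In the
  comparison of two coresolutions only the composite that returns to the given one is controlled, so
  the induction carries a one-sided inverse modulo V.\<close>

context category
begin

text \<open>Unfolding Hom sets into equations between domains and codomains lets the simplifier
  discharge composability conditions.\<close>

lemma in_Hom [simp]: "f \<in> Hom C A B \<longleftrightarrow> f \<in> Arr C \<and> Dom C f = A \<and> Cod C f = B"
  by (auto simp: Hom_def)

declare Dom_closed [simp] Cod_closed [simp]

lemma Ide_simps [simp]:
  assumes "A \<in> Ob C"
  shows "Ide C A \<in> Arr C" "Dom C (Ide C A) = A" "Cod C (Ide C A) = A"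
  using Ide_closed[OF assms] by auto

lemma comp_simps [simp]:
  assumes "f \<in> Arr C" "g \<in> Arr C" "Cod C f = Dom C g"
  shows "g \<cdot> f \<in> Arr C" "Dom C (g \<cdot> f) = Dom C f" "Cod C (g \<cdot> f) = Cod C g"
  using Comp_closed[of f "Dom C f" "Cod C f" g "Cod C g"] assms by auto

lemma comp_assoc [simp]:
  assumes "f \<in> Arr C" "g \<in> Arr C" "h \<in> Arr C" "Cod C f = Dom C g" "Cod C g = Dom C h"
  shows "(h \<cdot> g) \<cdot> f = h \<cdot> (g \<cdot> f)"
  using Comp_assoc[of f "Dom C f" "Cod C f" g "Cod C g" h "Cod C h"] assms by auto

text \<open>\<open>comp_assoc\<close> nests composites to the right, where a known value of
  \<open>g \<cdot> f\<close> no longer matches inside \<open>g \<cdot> (f \<cdot> x)\<close>. This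
  form makes it applicable again.\<close>

lemma comp_eq:
  assumes "g \<cdot> f = k" "x \<in> Arr C" "f \<in> Arr C" "g \<in> Arr C" "Cod C f = Dom C g" "Cod C x = Dom C f"
  shows "g \<cdot> (f \<cdot> x) = k \<cdot> x"
  using comp_assoc[of x f g] assms by auto

lemma comp_Ide [simp]:
  assumes "f \<in> Arr C"
  shows "Dom C f = A \<Longrightarrow> f \<cdot> Ide C A = f" "Cod C f = B \<Longrightarrow> Ide C B \<cdot> f = f"
  using Comp_Ide_right[of f A "Cod C f"] Comp_Ide_left[of f "Dom C f" B] assms by auto

lemma is_iso_Ide: "A \<in> Ob C \<Longrightarrow> is_iso C (Ide C A)"
  unfolding is_iso_def by (auto intro!: exI[of _ "Ide C A"])

text \<open>The same device for commutative squares.\<close>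

lemma comp_square:
  assumes "g \<cdot> f = g' \<cdot> f'" "x \<in> Arr C" "f \<in> Arr C" "g \<in> Arr C" "f' \<in> Arr C" "g' \<in> Arr C"
    "Cod C f = Dom C g" "Cod C f' = Dom C g'" "Cod C x = Dom C f" "Dom C f' = Dom C f"
  shows "g \<cdot> (f \<cdot> x) = g' \<cdot> (f' \<cdot> x)"
  using comp_assoc[of x f g] comp_assoc[of x f' g'] assms by simp

lemma is_isoD:
  assumes "is_iso C f"
  obtains g where "g \<in> Arr C" "Dom C g = Cod C f" "Cod C g = Dom C f"
    "g \<cdot> f = Ide C (Dom C f)" "f \<cdot> g = Ide C (Cod C f)"
  using assms unfolding is_iso_def by auto

end

section \<open>Negatives and differences of arrows\<close>

context preadditive_category
begin

text \<open>All Hom groups share the addition \<open>Plus C\<close>, but each has its own inverse.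
  Reading the endpoints off the arrow gives one operation for all of them.\<close>

definition neg :: "'b \<Rightarrow> 'b" where
  "neg f = inv\<^bsub>Hom_group C (Dom C f) (Cod C f)\<^esub> f"

definition sub :: "'b \<Rightarrow> 'b \<Rightarrow> 'b" where
  "sub f g = Plus C f (neg g)"

lemma Hom_group_simps [simp]:
  "carrier (Hom_group C A B) = Hom C A B" "mult (Hom_group C A B) = Plus C"
  "one (Hom_group C A B) = Null C A B"
  by (auto simp: Hom_group_def)

lemma Null_simps [simp]:
  assumes "A \<in> Ob C" "B \<in> Ob C"
  shows "Null C A B \<in> Arr C" "Dom C (Null C A B) = A" "Cod C (Null C A B) = B"
proof -
  interpret comm_group "Hom_group C A B" using Hom_comm_group assms .
  show "Null C A B \<in> Arr C" "Dom C (Null C A B) = A" "Cod C (Null C A B) = B"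
    using one_closed by auto
qed

lemma Plus_simps [simp]:
  assumes "f \<in> Arr C" "g \<in> Arr C" "Dom C g = Dom C f" "Cod C g = Cod C f"
  shows "Plus C f g \<in> Arr C" "Dom C (Plus C f g) = Dom C f" "Cod C (Plus C f g) = Cod C f"
proof -
  interpret comm_group "Hom_group C (Dom C f) (Cod C f)" using Hom_comm_group assms by auto
  show "Plus C f g \<in> Arr C" "Dom C (Plus C f g) = Dom C f" "Cod C (Plus C f g) = Cod C f"
    using m_closed[of f g] assms by auto
qed

lemma neg_simps [simp]:
  assumes "f \<in> Arr C"
  shows "neg f \<in> Arr C" "Dom C (neg f) = Dom C f" "Cod C (neg f) = Cod C f"
proof -
  interpret comm_group "Hom_group C (Dom C f) (Cod C f)" using Hom_comm_group assms by auto
  show "neg f \<in> Arr C" "Dom C (neg f) = Dom C f" "Cod C (neg f) = Cod C f"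
    using inv_closed[of f] assms by (auto simp: neg_def)
qed

lemma sub_simps [simp]:
  assumes "f \<in> Arr C" "g \<in> Arr C" "Dom C g = Dom C f" "Cod C g = Cod C f"
  shows "sub f g \<in> Arr C" "Dom C (sub f g) = Dom C f" "Cod C (sub f g) = Cod C f"
  using assms by (auto simp: sub_def)

lemma Plus_assoc:
  assumes "f \<in> Arr C" "g \<in> Arr C" "h \<in> Arr C" "Dom C g = Dom C f" "Cod C g = Cod C f"
    "Dom C h = Dom C f" "Cod C h = Cod C f"
  shows "Plus C (Plus C f g) h = Plus C f (Plus C g h)"
proof -
  interpret comm_group "Hom_group C (Dom C f) (Cod C f)" using Hom_comm_group assms by auto
  show ?thesis using m_assoc[of f g h] assms by auto
qed

lemma Plus_commute:
  assumes "f \<in> Arr C" "g \<in> Arr C" "Dom C g = Dom C f" "Cod C g = Cod C f"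
  shows "Plus C f g = Plus C g f"
proof -
  interpret comm_group "Hom_group C (Dom C f) (Cod C f)" using Hom_comm_group assms by auto
  show ?thesis using m_comm[of f g] assms by auto
qed

lemma Plus_Null [simp]:
  assumes "f \<in> Arr C" "Dom C f = A" "Cod C f = B"
  shows "Plus C f (Null C A B) = f" "Plus C (Null C A B) f = f"
proof -
  interpret comm_group "Hom_group C A B" using Hom_comm_group assms by auto
  show "Plus C f (Null C A B) = f" "Plus C (Null C A B) f = f"
    using r_one[of f] l_one[of f] assms by auto
qed

lemma Plus_neg [simp]:
  assumes "f \<in> Arr C"
  shows "Plus C f (neg f) = Null C (Dom C f) (Cod C f)"
    "Plus C (neg f) f = Null C (Dom C f) (Cod C f)"
proof -
  interpret comm_group "Hom_group C (Dom C f) (Cod C f)" using Hom_comm_group assms by auto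
  show "Plus C f (neg f) = Null C (Dom C f) (Cod C f)"
    "Plus C (neg f) f = Null C (Dom C f) (Cod C f)"
    using r_inv[of f] l_inv[of f] assms by (auto simp: neg_def)
qed

lemma sub_self [simp]: "f \<in> Arr C \<Longrightarrow> sub f f = Null C (Dom C f) (Cod C f)"
  by (simp add: sub_def)

lemma Plus_sub [simp]:
  assumes "f \<in> Arr C" "g \<in> Arr C" "Dom C g = Dom C f" "Cod C g = Cod C f"
  shows "Plus C (sub f g) g = f"
  using assms by (simp add: sub_def Plus_assoc)

lemma sub_Plus [simp]:
  assumes "f \<in> Arr C" "g \<in> Arr C" "Dom C g = Dom C f" "Cod C g = Cod C f"
  shows "sub (Plus C f g) g = f"
  using assms by (simp add: sub_def Plus_assoc)

lemma sub_eq_Null: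
  assumes "sub f g = Null C A B" "f \<in> Arr C" "g \<in> Arr C" "Dom C f = A" "Cod C f = B"
    "Dom C g = A" "Cod C g = B"
  shows "f = g"
  using Plus_sub[of f g] assms by simp

lemma comp_Plus [simp]:
  assumes "f \<in> Arr C" "f' \<in> Arr C" "g \<in> Arr C" "Dom C f' = Dom C f" "Cod C f' = Cod C f"
    "Cod C f = Dom C g"
  shows "g \<cdot> Plus C f f' = Plus C (g \<cdot> f) (g \<cdot> f')"
  using assms Comp_Plus_right[of f "Dom C f" "Cod C f" f' g "Cod C g"] by simp

lemma Plus_comp [simp]:
  assumes "f \<in> Arr C" "g \<in> Arr C" "g' \<in> Arr C" "Dom C g' = Dom C g" "Cod C g' = Cod C g"
    "Cod C f = Dom C g"
  shows "Plus C g g' \<cdot> f = Plus C (g \<cdot> f) (g' \<cdot> f)"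
  using assms Comp_Plus_left[of f "Dom C f" "Cod C f" g "Cod C g" g'] by simp

lemma Plus_idem_Null:
  assumes "Plus C f f = f" "f \<in> Arr C"
  shows "f = Null C (Dom C f) (Cod C f)"
  using sub_Plus[of f f] assms by simp

text \<open>By distributivity the composite is its own double, and in a group only the neutral
  element is.\<close>

lemma comp_Null [simp]:
  assumes "f \<in> Arr C" "A \<in> Ob C" "Dom C f = B"
  shows "f \<cdot> Null C A B = Null C A (Cod C f)"
proof -
  have B: "B \<in> Ob C" using assms by auto
  have "Plus C (f \<cdot> Null C A B) (f \<cdot> Null C A B) = f \<cdot> Plus C (Null C A B) (Null C A B)"
    using assms B by (intro comp_Plus[symmetric]) auto
  then show ?thesis using Plus_idem_Null[of "f \<cdot> Null C A B"] assms B by simp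
qed

lemma Null_comp [simp]:
  assumes "f \<in> Arr C" "B \<in> Ob C" "Cod C f = A"
  shows "Null C A B \<cdot> f = Null C (Dom C f) B"
proof -
  have A: "A \<in> Ob C" using assms by auto
  have "Plus C (Null C A B \<cdot> f) (Null C A B \<cdot> f) = Plus C (Null C A B) (Null C A B) \<cdot> f"
    using assms A by (intro Plus_comp[symmetric]) auto
  then show ?thesis using Plus_idem_Null[of "Null C A B \<cdot> f"] assms A by simp
qed

lemma neg_unique:
  assumes "Plus C f g = Null C (Dom C f) (Cod C f)" "f \<in> Arr C" "g \<in> Arr C"
    "Dom C g = Dom C f" "Cod C g = Cod C f"
  shows "neg f = g"
proof -
  have "neg f = Plus C (neg f) (Plus C f g)" using assms by simp
  also have "\<dots> = g" using assms Plus_assoc[of "neg f" f g] by simp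
  finally show ?thesis .
qed

lemma comp_neg [simp]:
  assumes "f \<in> Arr C" "g \<in> Arr C" "Cod C f = Dom C g"
  shows "g \<cdot> neg f = neg (g \<cdot> f)"
  using assms by (intro neg_unique[symmetric]) (auto simp flip: comp_Plus)

lemma neg_comp [simp]:
  assumes "f \<in> Arr C" "g \<in> Arr C" "Cod C f = Dom C g"
  shows "neg g \<cdot> f = neg (g \<cdot> f)"
  using assms by (intro neg_unique[symmetric]) (auto simp flip: Plus_comp)

lemma neg_neg [simp]: "f \<in> Arr C \<Longrightarrow> neg (neg f) = f"
  by (intro neg_unique) auto

lemma neg_Null [simp]: "A \<in> Ob C \<Longrightarrow> B \<in> Ob C \<Longrightarrow> neg (Null C A B) = Null C A B"
  by (intro neg_unique) auto

lemma comp_sub [simp]: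
  assumes "f \<in> Arr C" "f' \<in> Arr C" "g \<in> Arr C" "Dom C f' = Dom C f" "Cod C f' = Cod C f"
    "Cod C f = Dom C g"
  shows "g \<cdot> sub f f' = sub (g \<cdot> f) (g \<cdot> f')"
  using assms by (simp add: sub_def)

lemma sub_comp [simp]:
  assumes "f \<in> Arr C" "g \<in> Arr C" "g' \<in> Arr C" "Dom C g' = Dom C g" "Cod C g' = Cod C g"
    "Cod C f = Dom C g"
  shows "sub g g' \<cdot> f = sub (g \<cdot> f) (g' \<cdot> f)"
  using assms by (simp add: sub_def)

lemma sub_Null [simp]:
  assumes "f \<in> Arr C" "Dom C f = A" "Cod C f = B"
  shows "sub f (Null C A B) = f" "sub (Null C A B) f = neg f"
  using assms by (auto simp: sub_def)

lemma sub_sub [simp]: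
  assumes "f \<in> Arr C" "g \<in> Arr C" "Dom C g = Dom C f" "Cod C g = Cod C f"
  shows "sub f (sub f g) = g"
proof -
  have "neg (sub f g) = sub g f"
  proof (rule neg_unique)
    show "Plus C (sub f g) (sub g f) = Null C (Dom C (sub f g)) (Cod C (sub f g))"
      using assms Plus_assoc[of "sub f g" g "neg f"] by (simp add: sub_def[of g f])
  qed (use assms in auto)
  then show ?thesis
    using assms by (simp add: sub_def[of f "sub f g"] Plus_commute[of f])
qed

section \<open>Monomorphisms, epimorphisms, kernels and cokernels\<close>

text \<open>Applied to the difference of two arrows, the condition on arrows killed by
  \<open>f\<close> already gives cancellation.\<close>

lemma is_monoI:
  assumes "f \<in> Arr C"
    and "\<And>g. g \<in> Arr C \<Longrightarrow> Cod C g = Dom C f \<Longrightarrow> f \<cdot> g = Null C (Dom C g) (Cod C f) \<Longrightarrow>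
      g = Null C (Dom C g) (Cod C g)"
  shows "is_mono C f"
  unfolding is_mono_def
proof (intro conjI ballI impI)
  fix A g h assume "A \<in> Ob C" "g \<in> Hom C A (Dom C f)" "h \<in> Hom C A (Dom C f)" "f \<cdot> g = f \<cdot> h"
  then show "g = h"
    using assms(2)[of "sub g h"] assms(1) by (intro sub_eq_Null[of g h]) auto
qed (use assms in auto)

lemma is_epiI:
  assumes "f \<in> Arr C"
    and "\<And>g. g \<in> Arr C \<Longrightarrow> Dom C g = Cod C f \<Longrightarrow> g \<cdot> f = Null C (Dom C f) (Cod C g) \<Longrightarrow>
      g = Null C (Dom C g) (Cod C g)"
  shows "is_epi C f"
  unfolding is_epi_def
proof (intro conjI ballI impI)
  fix B g h assume "B \<in> Ob C" "g \<in> Hom C (Cod C f) B" "h \<in> Hom C (Cod C f) B" "g \<cdot> f = h \<cdot> f"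
  then show "g = h"
    using assms(2)[of "sub g h"] assms(1) by (intro sub_eq_Null[of g h]) auto
qed (use assms in auto)

lemma is_monoD:
  assumes "is_mono C f" "f \<cdot> g = f \<cdot> h" "g \<in> Arr C" "h \<in> Arr C" "Dom C g = Dom C h"
    "Cod C g = Dom C f" "Cod C h = Dom C f"
  shows "g = h"
proof -
  have "Dom C h \<in> Ob C" using assms by simp
  then show ?thesis using assms unfolding is_mono_def by (metis in_Hom)
qed

lemma is_epiD:
  assumes "is_epi C f" "g \<cdot> f = h \<cdot> f" "g \<in> Arr C" "h \<in> Arr C" "Cod C g = Cod C h"
    "Dom C g = Cod C f" "Dom C h = Cod C f"
  shows "g = h"
proof -
  have "Cod C h \<in> Ob C" using assms by simp
  then show ?thesis using assms unfolding is_epi_def by (metis in_Hom)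
qed

lemma is_mono_comp:
  assumes "is_mono C f" "is_mono C g" "Cod C f = Dom C g"
  shows "is_mono C (g \<cdot> f)"
  unfolding is_mono_def
proof (intro conjI ballI impI)
  have fg: "f \<in> Arr C" "g \<in> Arr C" using assms unfolding is_mono_def by auto
  show "g \<cdot> f \<in> Arr C" using assms fg by simp
  fix A h k assume hk: "h \<in> Hom C A (Dom C (g \<cdot> f))" "k \<in> Hom C A (Dom C (g \<cdot> f))"
    "g \<cdot> f \<cdot> h = g \<cdot> f \<cdot> k"
  have "f \<cdot> h = f \<cdot> k" by (rule is_monoD[OF assms(2)]) (use fg assms hk in auto)
  then show "h = k" by (rule is_monoD[OF assms(1)]) (use fg assms hk in auto)
qed

lemma kernel_simps:
  assumes "is_kernel C k f"
  shows "f \<in> Arr C" "k \<in> Arr C" "Cod C k = Dom C f" "f \<cdot> k = Null C (Dom C k) (Cod C f)"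
  using assms unfolding is_kernel_def by auto

lemma cokernel_simps:
  assumes "is_cokernel C c f"
  shows "f \<in> Arr C" "c \<in> Arr C" "Dom C c = Cod C f" "c \<cdot> f = Null C (Dom C f) (Cod C c)"
  using assms unfolding is_cokernel_def by auto

lemma kernel_lift:
  assumes "is_kernel C k f" "h \<in> Arr C" "Cod C h = Dom C f" "f \<cdot> h = Null C (Dom C h) (Cod C f)"
  obtains u where "u \<in> Arr C" "Dom C u = Dom C h" "Cod C u = Dom C k" "k \<cdot> u = h"
proof -
  have "\<exists>!u. u \<in> Hom C (Dom C h) (Dom C k) \<and> k \<cdot> u = h"
    using assms unfolding is_kernel_def by auto
  then show ?thesis using that by auto
qed

lemma cokernel_desc:
  assumes "is_cokernel C c f" "h \<in> Arr C" "Dom C h = Cod C f" "h \<cdot> f = Null C (Dom C f) (Cod C h)"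
  obtains u where "u \<in> Arr C" "Dom C u = Cod C c" "Cod C u = Cod C h" "u \<cdot> c = h"
proof -
  have "\<exists>!u. u \<in> Hom C (Cod C c) (Cod C h) \<and> u \<cdot> c = h"
    using assms unfolding is_cokernel_def by auto
  then show ?thesis using that by auto
qed

lemma kernel_mono:
  assumes "is_kernel C k f"
  shows "is_mono C k"
proof (rule is_monoI)
  note k = kernel_simps[OF assms]
  show "k \<in> Arr C" by fact
  fix g assume g: "g \<in> Arr C" "Cod C g = Dom C k" "k \<cdot> g = Null C (Dom C g) (Cod C k)"
  have "\<exists>!u. u \<in> Hom C (Dom C g) (Dom C k) \<and> k \<cdot> u = Null C (Dom C g) (Cod C k)"
    using assms g k unfolding is_kernel_def by auto
  moreover have "Null C (Dom C g) (Dom C k) \<in> Hom C (Dom C g) (Dom C k) \<and>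
      k \<cdot> Null C (Dom C g) (Dom C k) = Null C (Dom C g) (Cod C k)"
    "g \<in> Hom C (Dom C g) (Dom C k) \<and> k \<cdot> g = Null C (Dom C g) (Cod C k)"
    using g k by auto
  ultimately have "g = Null C (Dom C g) (Dom C k)" by blast
  then show "g = Null C (Dom C g) (Cod C g)" using g by simp
qed

lemma cokernel_epi:
  assumes "is_cokernel C c f"
  shows "is_epi C c"
proof (rule is_epiI)
  note c = cokernel_simps[OF assms]
  show "c \<in> Arr C" by fact
  fix g assume g: "g \<in> Arr C" "Dom C g = Cod C c" "g \<cdot> c = Null C (Dom C c) (Cod C g)"
  have "\<exists>!u. u \<in> Hom C (Cod C c) (Cod C g) \<and> u \<cdot> c = Null C (Dom C c) (Cod C g)"
    using assms g c unfolding is_cokernel_def by auto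
  moreover have "Null C (Cod C c) (Cod C g) \<in> Hom C (Cod C c) (Cod C g) \<and>
      Null C (Cod C c) (Cod C g) \<cdot> c = Null C (Dom C c) (Cod C g)"
    "g \<in> Hom C (Cod C c) (Cod C g) \<and> g \<cdot> c = Null C (Dom C c) (Cod C g)"
    using g c by auto
  ultimately have "g = Null C (Cod C c) (Cod C g)" by blast
  then show "g = Null C (Dom C g) (Cod C g)" using g by simp
qed

lemma is_kernelI:
  assumes "is_mono C k" "f \<in> Arr C" "Cod C k = Dom C f" "f \<cdot> k = Null C (Dom C k) (Cod C f)"
    and "\<And>h. h \<in> Arr C \<Longrightarrow> Cod C h = Dom C f \<Longrightarrow> f \<cdot> h = Null C (Dom C h) (Cod C f) \<Longrightarrow>
      \<exists>u \<in> Hom C (Dom C h) (Dom C k). k \<cdot> u = h"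
  shows "is_kernel C k f"
  unfolding is_kernel_def
proof (intro conjI ballI impI)
  show k: "k \<in> Arr C" using assms unfolding is_mono_def by auto
  fix A h assume h: "A \<in> Ob C" "h \<in> Hom C A (Dom C f)" "f \<cdot> h = Null C A (Cod C f)"
  then obtain u where "u \<in> Hom C (Dom C h) (Dom C k)" "k \<cdot> u = h" using assms(5)[of h] by auto
  then show "\<exists>!u. u \<in> Hom C A (Dom C k) \<and> k \<cdot> u = h"
    using h by (intro ex1I[of _ u]) (auto dest: is_monoD[OF assms(1)])
qed (use assms in auto)

lemma is_cokernelI:
  assumes "is_epi C c" "f \<in> Arr C" "Dom C c = Cod C f" "c \<cdot> f = Null C (Dom C f) (Cod C c)"
    and "\<And>h. h \<in> Arr C \<Longrightarrow> Dom C h = Cod C f \<Longrightarrow> h \<cdot> f = Null C (Dom C f) (Cod C h) \<Longrightarrow>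
      \<exists>u \<in> Hom C (Cod C c) (Cod C h). u \<cdot> c = h"
  shows "is_cokernel C c f"
  unfolding is_cokernel_def
proof (intro conjI ballI impI)
  show c: "c \<in> Arr C" using assms unfolding is_epi_def by auto
  fix B h assume h: "B \<in> Ob C" "h \<in> Hom C (Cod C f) B" "h \<cdot> f = Null C (Dom C f) B"
  then obtain u where "u \<in> Hom C (Cod C c) (Cod C h)" "u \<cdot> c = h" using assms(5)[of h] by auto
  then show "\<exists>!u. u \<in> Hom C (Cod C c) B \<and> u \<cdot> c = h"
    using h by (intro ex1I[of _ u]) (auto dest: is_epiD[OF assms(1)])
qed (use assms in auto)

text \<open>\<open>f\<close> kills \<open>k\<close>, so it factors through \<open>c\<close>; hence
  whatever \<open>c\<close> kills is killed by \<open>f\<close> and lifts along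
  \<open>k\<close>.\<close>

lemma kernel_of_cokernel:
  assumes "is_kernel C k f" "is_cokernel C c k"
  shows "is_kernel C k c"
proof (rule is_kernelI)
  note k = kernel_simps[OF assms(1)] and c = cokernel_simps[OF assms(2)]
  show "is_mono C k" using assms kernel_mono by blast
  show "c \<in> Arr C" "Cod C k = Dom C c" "c \<cdot> k = Null C (Dom C k) (Cod C c)" using c by auto
  fix h assume h: "h \<in> Arr C" "Cod C h = Dom C c" "c \<cdot> h = Null C (Dom C h) (Cod C c)"
  obtain v where v: "v \<in> Arr C" "Dom C v = Cod C c" "Cod C v = Cod C f" "v \<cdot> c = f"
    using cokernel_desc[OF assms(2), of f] k by auto
  have "f \<cdot> h = v \<cdot> (c \<cdot> h)" using v h c comp_assoc[of h c v] by auto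
  then have "f \<cdot> h = Null C (Dom C h) (Cod C f)" using h v by simp
  then show "\<exists>u \<in> Hom C (Dom C h) (Dom C k). k \<cdot> u = h"
    using kernel_lift[OF assms(1), of h] h k c by (metis in_Hom)
qed

lemma cokernel_of_kernel:
  assumes "is_cokernel C c f" "is_kernel C k c"
  shows "is_cokernel C c k"
proof (rule is_cokernelI)
  note c = cokernel_simps[OF assms(1)] and k = kernel_simps[OF assms(2)]
  show "is_epi C c" using assms cokernel_epi by blast
  show "k \<in> Arr C" "Dom C c = Cod C k" "c \<cdot> k = Null C (Dom C k) (Cod C c)" using k by auto
  fix h assume h: "h \<in> Arr C" "Dom C h = Cod C k" "h \<cdot> k = Null C (Dom C k) (Cod C h)"
  obtain v where v: "v \<in> Arr C" "Dom C v = Dom C f" "Cod C v = Dom C k" "k \<cdot> v = f"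
    using kernel_lift[OF assms(2), of f] c by auto
  have "h \<cdot> f = (h \<cdot> k) \<cdot> v" using comp_assoc[of v k h] v h k by metis
  then have "h \<cdot> f = Null C (Dom C f) (Cod C h)" using h v by simp
  then show "\<exists>u \<in> Hom C (Cod C c) (Cod C h). u \<cdot> c = h"
    using cokernel_desc[OF assms(1), of h] h k c by (metis in_Hom)
qed

section \<open>Biproducts and short exact sequences\<close>

lemma biproduct_simps:
  assumes "is_biproduct C A B S i j p q"
  shows "i \<in> Arr C" "j \<in> Arr C" "p \<in> Arr C" "q \<in> Arr C"
    "Dom C i = A" "Dom C j = B" "Cod C i = S" "Cod C j = S"
    "Dom C p = S" "Dom C q = S" "Cod C p = A" "Cod C q = B"
    "p \<cdot> i = Ide C A" "q \<cdot> j = Ide C B" "q \<cdot> i = Null C A B" "p \<cdot> j = Null C B A"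
    "Plus C (i \<cdot> p) (j \<cdot> q) = Ide C S"
  using assms by (auto simp: is_biproduct_def)

lemma biproduct_comp:
  assumes "is_biproduct C A B S i j p q" "x \<in> Arr C"
  shows "Cod C x = A \<Longrightarrow> p \<cdot> (i \<cdot> x) = x" "Cod C x = A \<Longrightarrow> q \<cdot> (i \<cdot> x) = Null C (Dom C x) B"
    "Cod C x = B \<Longrightarrow> p \<cdot> (j \<cdot> x) = Null C (Dom C x) A" "Cod C x = B \<Longrightarrow> q \<cdot> (j \<cdot> x) = x"
  using biproduct_simps[OF assms(1)] assms(2) Dom_closed[of i] Dom_closed[of j]
  by (simp_all flip: comp_assoc)

lemma biproduct_decomp:
  assumes S: "is_biproduct C A B S i j p q" and x: "x \<in> Arr C"
  shows "Dom C x = S \<Longrightarrow> x = Plus C (x \<cdot> i \<cdot> p) (x \<cdot> j \<cdot> q)"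
    "Cod C x = S \<Longrightarrow> x = Plus C (i \<cdot> (p \<cdot> x)) (j \<cdot> (q \<cdot> x))"
proof -
  note b = biproduct_simps[OF S]
  show "x = Plus C (x \<cdot> i \<cdot> p) (x \<cdot> j \<cdot> q)" if "Dom C x = S"
    using comp_Plus[of "i \<cdot> p" "j \<cdot> q" x] b x that by simp
  show "x = Plus C (i \<cdot> (p \<cdot> x)) (j \<cdot> (q \<cdot> x))" if "Cod C x = S"
    using Plus_comp[of x "i \<cdot> p" "j \<cdot> q"] b x that by simp
qed

lemma short_exact_simps:
  assumes "short_exact C i p"
  shows "i \<in> Arr C" "p \<in> Arr C" "Dom C p = Cod C i" "p \<cdot> i = Null C (Dom C i) (Cod C p)"
    "is_mono C i" "is_epi C p" "is_kernel C i p" "is_cokernel C p i"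
  using assms kernel_simps[of i p] kernel_mono[of i p] cokernel_epi[of p i]
  by (auto simp: short_exact_def)

text \<open>As \<open>s\<close> kills \<open>j\<close>, it equals \<open>t \<cdot> q\<close> for
  some \<open>t\<close>. Then \<open>t \<cdot> p\<close> is \<open>s \<cdot> \<alpha>\<close>, which
  is zero, and \<open>p\<close> is epi.\<close>

lemma extension_jointly_epi:
  assumes e: "short_exact C i p" and x: "short_exact C j q"
    and \<alpha>: "\<alpha> \<in> Hom C (Cod C i) (Cod C j)" "q \<cdot> \<alpha> = p"
    and s: "s \<in> Hom C (Cod C j) T" "s \<cdot> \<alpha> = Null C (Cod C i) T" "s \<cdot> j = Null C (Dom C j) T"
  shows "s = Null C (Cod C j) T"
proof -
  note e' = short_exact_simps[OF e] and x' = short_exact_simps[OF x]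
  obtain t where t: "t \<in> Arr C" "Dom C t = Cod C q" "Cod C t = T" "t \<cdot> q = s"
    using cokernel_desc[OF x'(8), of s] s x' by auto
  have T: "T \<in> Ob C" using t by auto
  have "t \<cdot> p = (t \<cdot> q) \<cdot> \<alpha>" using t(1-3) \<alpha> x' by simp
  also have "\<dots> = Null C (Dom C q) T \<cdot> \<alpha>" using t(4) s \<alpha> T x' by simp
  also have "\<dots> = Null C (Cod C q) T \<cdot> p" using \<alpha> e' x' T by auto
  finally have "t = Null C (Cod C q) T"
    by (rule is_epiD[OF e'(6)]) (use t \<alpha> e' x' T in auto)
  then show ?thesis using t x' T by simp
qed

text \<open>Dually, \<open>s\<close> equals \<open>j \<cdot> t\<close> for some \<open>t\<close>,
  and \<open>i \<cdot> t\<close> is \<open>\<psi> \<cdot> s\<close>, which is zero, with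
  \<open>i\<close> mono.\<close>

lemma extension_jointly_mono:
  assumes x: "short_exact C j q" and e: "short_exact C i p"
    and \<psi>: "\<psi> \<in> Hom C (Cod C j) (Cod C i)" "\<psi> \<cdot> j = i"
    and s: "s \<in> Hom C T (Cod C j)" "\<psi> \<cdot> s = Null C T (Cod C i)" "q \<cdot> s = Null C T (Cod C q)"
  shows "s = Null C T (Cod C j)"
proof -
  note e' = short_exact_simps[OF e] and x' = short_exact_simps[OF x]
  obtain t where t: "t \<in> Arr C" "Dom C t = T" "Cod C t = Dom C j" "j \<cdot> t = s"
    using kernel_lift[OF x'(7), of s] s x' by auto
  have T: "T \<in> Ob C" using t by auto
  have ij: "Dom C i = Dom C j" using \<psi> x' by auto
  have "i \<cdot> t = \<psi> \<cdot> s" using t comp_eq[OF \<psi>(2), of t] \<psi> x' by simp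
  also have "\<dots> = i \<cdot> Null C T (Dom C i)" using s e' T by simp
  finally have "t = Null C T (Dom C i)"
    by (rule is_monoD[OF e'(5)]) (use t ij e' T Dom_closed[OF e'(1)] in auto)
  then show ?thesis using t x' T ij by simp
qed

section \<open>The connecting maps in terms of one representative\<close>

lemma mem_extensions [simp]:
  "(i, p) \<in> extensions C X A \<longleftrightarrow> short_exact C i p \<and> Dom C i = A \<and> Cod C p = X"
  by (auto simp: extensions_def)

lemma mem_ext_class:
  assumes "short_exact C i p"
  shows "(j, q) \<in> ext_class C (i, p) \<longleftrightarrow> short_exact C j q \<and> Dom C j = Dom C i \<and> Cod C q = Cod C p \<and>
    (\<exists>\<chi> \<in> Hom C (Cod C i) (Cod C j). is_iso C \<chi> \<and> \<chi> \<cdot> i = j \<and> q \<cdot> \<chi> = p)"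
  using assms by (auto simp: ext_class_def ext_rel_def)

text \<open>The definition ranges over all members of the class of \<open>(i, p)\<close>.
  Precomposing with the isomorphism from \<open>(i, p)\<close> to another member reduces everything
  to this one.\<close>

lemma mem_delta:
  assumes e: "short_exact C i p" and f: "f \<in> Hom C (Dom C i) N"
  shows "(j, q) \<in> delta C (i, p) f \<longleftrightarrow> short_exact C j q \<and> Dom C j = N \<and> Cod C q = Cod C p \<and>
    (\<exists>\<phi> \<in> Hom C (Cod C i) (Cod C j). \<phi> \<cdot> i = j \<cdot> f \<and> q \<cdot> \<phi> = p)" (is "?L \<longleftrightarrow> ?R")
proof
  note e' = short_exact_simps[OF e]
  assume ?L
  then obtain i1 p1 \<phi> where 1: "(i1, p1) \<in> ext_class C (i, p)" "\<phi> \<in> Hom C (Cod C i1) (Cod C j)"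
      "\<phi> \<cdot> i1 = j \<cdot> f" "q \<cdot> \<phi> = p1" and x: "short_exact C j q" "Dom C j = N" "Cod C q = Cod C p"
    using f by (auto simp: delta_def Ext1_push_def)
  note x' = short_exact_simps[OF x(1)]
  obtain \<chi> where \<chi>: "\<chi> \<in> Hom C (Cod C i) (Cod C i1)" "\<chi> \<cdot> i = i1" "p1 \<cdot> \<chi> = p"
    using 1 mem_ext_class[OF e] by auto
  have "(\<phi> \<cdot> \<chi>) \<cdot> i = j \<cdot> f" "q \<cdot> (\<phi> \<cdot> \<chi>) = p"
    using 1 \<chi> e' comp_eq[OF 1(4), of \<chi>] x' by auto
  then show ?R using x 1 \<chi> by (auto intro!: exI[of _ "\<phi> \<cdot> \<chi>"])
next
  note e' = short_exact_simps[OF e]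
  assume R: ?R
  have "(i, p) \<in> ext_class C (i, p)"
    using e' e by (auto simp: mem_ext_class is_iso_Ide intro!: bexI[of _ "Ide C (Cod C i)"])
  then show ?L using R f by (auto simp: delta_def Ext1_push_def)
qed

text \<open>Here the comparison maps end in the extension, so the isomorphism between two members of
  the class has to be inverted.\<close>

lemma mem_partial:
  assumes e: "short_exact C i p" and g: "g \<in> Hom C X (Cod C p)"
  shows "(j, q) \<in> partial C (i, p) g \<longleftrightarrow> short_exact C j q \<and> Dom C j = Dom C i \<and> Cod C q = X \<and>
    (\<exists>\<phi> \<in> Hom C (Cod C j) (Cod C i). \<phi> \<cdot> j = i \<and> p \<cdot> \<phi> = g \<cdot> q)" (is "?L \<longleftrightarrow> ?R")
proof
  note e' = short_exact_simps[OF e]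
  assume ?L
  then obtain i1 p1 \<phi> where 1: "(i1, p1) \<in> ext_class C (i, p)" "\<phi> \<in> Hom C (Cod C j) (Cod C i1)"
      "\<phi> \<cdot> j = i1" "p1 \<cdot> \<phi> = g \<cdot> q" and x: "short_exact C j q" "Dom C j = Dom C i" "Cod C q = X"
    using g by (auto simp: partial_def Ext1_pull_def)
  note x' = short_exact_simps[OF x(1)]
  obtain \<chi> where \<chi>: "\<chi> \<in> Hom C (Cod C i) (Cod C i1)" "\<chi> \<cdot> i = i1" "p1 \<cdot> \<chi> = p" "is_iso C \<chi>"
      and e1: "short_exact C i1 p1"
    using 1 mem_ext_class[OF e] by auto
  note e1' = short_exact_simps[OF e1]
  obtain \<chi>' where \<chi>': "\<chi>' \<in> Arr C" "Dom C \<chi>' = Cod C i1" "Cod C \<chi>' = Cod C i"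
    "\<chi>' \<cdot> \<chi> = Ide C (Cod C i)" "\<chi> \<cdot> \<chi>' = Ide C (Cod C i1)"
    using is_isoD[OF \<chi>(4)] \<chi>(1) by auto
  have "\<chi>' \<cdot> i1 = (\<chi>' \<cdot> \<chi>) \<cdot> i" using \<chi>(1,2) \<chi>'(1-3) e' by simp
  then have i: "\<chi>' \<cdot> i1 = i" using \<chi>' e' by simp
  have "p \<cdot> \<chi>' = p1 \<cdot> (\<chi> \<cdot> \<chi>')" using comp_eq[OF \<chi>(3), of \<chi>'] \<chi>(1) \<chi>'(1-3) e1' by simp
  then have p: "p \<cdot> \<chi>' = p1" using \<chi>' e1' by simp
  have "(\<chi>' \<cdot> \<phi>) \<cdot> j = i" "p \<cdot> (\<chi>' \<cdot> \<phi>) = g \<cdot> q"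
    using 1 \<chi>' i x' e' comp_eq[OF p, of \<phi>] by auto
  then show ?R using x 1 \<chi>' by (auto intro!: exI[of _ "\<chi>' \<cdot> \<phi>"])
next
  note e' = short_exact_simps[OF e]
  assume R: ?R
  have "(i, p) \<in> ext_class C (i, p)"
    using e' e by (auto simp: mem_ext_class is_iso_Ide intro!: bexI[of _ "Ide C (Cod C i)"])
  then show ?L using R g by (auto simp: partial_def Ext1_pull_def)
qed

text \<open>A kernel depends on an arrow only through the arrows that it kills.\<close>

lemma is_kernel_cong:
  assumes k: "is_kernel C k f" and g: "g \<in> Arr C" "Dom C g = Dom C f"
    and eq: "\<And>h. h \<in> Arr C \<Longrightarrow> Cod C h = Dom C f \<Longrightarrow>
      g \<cdot> h = Null C (Dom C h) (Cod C g) \<longleftrightarrow> f \<cdot> h = Null C (Dom C h) (Cod C f)"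
  shows "is_kernel C k g"
proof (rule is_kernelI)
  note k' = kernel_simps[OF k]
  show "is_mono C k" using k by (rule kernel_mono)
  show "g \<cdot> k = Null C (Dom C k) (Cod C g)" using eq k' by simp
  fix h assume h: "h \<in> Arr C" "Cod C h = Dom C g" "g \<cdot> h = Null C (Dom C h) (Cod C g)"
  then have "f \<cdot> h = Null C (Dom C h) (Cod C f)" using eq g by simp
  then obtain u where "u \<in> Arr C" "Dom C u = Dom C h" "Cod C u = Dom C k" "k \<cdot> u = h"
    using kernel_lift[OF k, of h] h g by auto
  then show "\<exists>u \<in> Hom C (Dom C h) (Dom C k). k \<cdot> u = h" by auto
qed (use g kernel_simps[OF k] in auto)

lemma mono_comp_Null:
  assumes "is_mono C m" "m \<cdot> f = Null C (Dom C f) (Cod C m)" "f \<in> Arr C" "Cod C f = Dom C m"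
  shows "f = Null C (Dom C f) (Cod C f)"
proof -
  have m: "m \<in> Arr C" using assms by (simp add: is_mono_def)
  show ?thesis by (rule is_monoD[OF assms(1)]) (use assms m in auto)
qed

lemma epi_comp_Null:
  assumes "is_epi C e" "f \<cdot> e = Null C (Dom C e) (Cod C f)" "f \<in> Arr C" "Dom C f = Cod C e"
  shows "f = Null C (Dom C f) (Cod C f)"
proof -
  have e: "e \<in> Arr C" using assms by (simp add: is_epi_def)
  show ?thesis by (rule is_epiD[OF assms(1)]) (use assms e in auto)
qed

lemma is_kernel_mono_comp:
  assumes m: "is_mono C m" and f: "f \<in> Arr C" "Cod C f = Dom C m"
  shows "is_kernel C k (m \<cdot> f) \<longleftrightarrow> is_kernel C k f"
proof -
  have m': "m \<in> Arr C" using assms by (simp add: is_mono_def)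
  have "m \<cdot> f \<cdot> h = Null C (Dom C h) (Cod C (m \<cdot> f)) \<longleftrightarrow> f \<cdot> h = Null C (Dom C h) (Cod C f)"
    if "h \<in> Arr C" "Cod C h = Dom C f" for h
    using mono_comp_Null[OF m, of "f \<cdot> h"] that f m' by auto
  then show ?thesis using is_kernel_cong[of k f "m \<cdot> f"] is_kernel_cong[of k "m \<cdot> f" f] f m'
    by auto
qed

text \<open>Cancelling \<open>e\<close> shows that an arrow killing \<open>f \<cdot> e\<close> kills
  \<open>f\<close>.\<close>

lemma is_cokernel_comp_epi:
  assumes c: "is_cokernel C c (f \<cdot> e)" and e: "is_epi C e" and f: "f \<in> Arr C" "Cod C e = Dom C f"
  shows "is_cokernel C c f"
proof (rule is_cokernelI)
  have e': "e \<in> Arr C" using e by (simp add: is_epi_def)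
  note c' = cokernel_simps[OF c]
  show "is_epi C c" using c by (rule cokernel_epi)
  have "(c \<cdot> f) \<cdot> e = Null C (Dom C e) (Cod C c)" using c' e' f by simp
  then show "c \<cdot> f = Null C (Dom C f) (Cod C c)" using epi_comp_Null[OF e, of "c \<cdot> f"] c' e' f by simp
  fix h assume h: "h \<in> Arr C" "Dom C h = Cod C f" "h \<cdot> f = Null C (Dom C f) (Cod C h)"
  have "h \<cdot> (f \<cdot> e) = Null C (Dom C e) (Cod C h)" using comp_eq[OF h(3), of e] h e' f by simp
  then obtain u where "u \<in> Arr C" "Dom C u = Cod C c" "Cod C u = Cod C h" "u \<cdot> c = h"
    using cokernel_desc[OF c, of h] h e' f by auto
  then show "\<exists>u \<in> Hom C (Cod C c) (Cod C h). u \<cdot> c = h" by auto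
qed (use cokernel_simps[OF c] f e in \<open>auto simp: is_epi_def\<close>)

lemma zero_object_Ob: "is_zero_object C Z \<Longrightarrow> Z \<in> Ob C"
  by (simp add: is_zero_object_def)

lemma zero_object_Dom:
  assumes "is_zero_object C Z" "f \<in> Arr C" "Dom C f = Z"
  shows "f = Null C Z (Cod C f)"
proof -
  have "\<exists>!g. g \<in> Hom C Z (Cod C f)" using assms by (simp add: is_zero_object_def)
  then show ?thesis using assms zero_object_Ob[OF assms(1)] by (elim ex1E) (metis Cod_closed Null_simps in_Hom)
qed

lemma zero_object_Cod:
  assumes "is_zero_object C Z" "f \<in> Arr C" "Cod C f = Z"
  shows "f = Null C (Dom C f) Z"
proof -
  have "\<exists>!g. g \<in> Hom C (Dom C f) Z" using assms by (simp add: is_zero_object_def)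
  then show ?thesis using assms zero_object_Ob[OF assms(1)] by (elim ex1E) (metis Dom_closed Null_simps in_Hom)
qed

end

section \<open>Morphisms of extensions\<close>

context abelian_category
begin

text \<open>Normality provides some arrow of which \<open>c\<close> is a cokernel;
  \<open>cokernel_of_kernel\<close> replaces that arrow by the kernel of \<open>c\<close>.\<close>

lemma epi_is_cokernel: "is_epi C c \<Longrightarrow> is_kernel C k c \<Longrightarrow> is_cokernel C c k"
  using epi_normal cokernel_of_kernel by blast

lemma mono_is_kernel: "is_mono C k \<Longrightarrow> is_cokernel C c k \<Longrightarrow> is_kernel C k c"
  using mono_normal kernel_of_cokernel by blast

text \<open>The left square of a morphism of extensions that is the identity on the quotient is a
  pushout; this is the existence half of the universal property. The arrow \<open>d\<close> with
  components \<open>\<alpha>\<close> and \<open>- j\<close> is epi, hence the cokernel of its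
  kernel, and it remains to see that the arrow with components \<open>u\<close> and
  \<open>- v\<close> vanishes on that kernel.\<close>

lemma extension_pushout:
  assumes e: "short_exact C i p" and x: "short_exact C j q"
    and f: "f \<in> Hom C (Dom C i) (Dom C j)"
    and \<alpha>: "\<alpha> \<in> Hom C (Cod C i) (Cod C j)" "\<alpha> \<cdot> i = j \<cdot> f" "q \<cdot> \<alpha> = p"
    and u: "u \<in> Hom C (Cod C i) T" and v: "v \<in> Hom C (Dom C j) T" and uv: "u \<cdot> i = v \<cdot> f"
  obtains \<psi> where "\<psi> \<in> Hom C (Cod C j) T" "\<psi> \<cdot> \<alpha> = u" "\<psi> \<cdot> j = v"
proof -
  note e' = short_exact_simps[OF e] and x' = short_exact_simps[OF x]
  note [simp] = e'(1-3) x'(1-3)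
  have [simp]: "f \<in> Arr C" "Dom C f = Dom C i" "Cod C f = Dom C j"
    "\<alpha> \<in> Arr C" "Dom C \<alpha> = Cod C i" "Cod C \<alpha> = Cod C j" "u \<in> Arr C" "v \<in> Arr C"
    "Dom C u = Cod C i" "Cod C u = T" "Dom C v = Dom C j" "Cod C v = T" "Cod C q = Cod C p"
    using f \<alpha> u v by auto
  have T [simp]: "T \<in> Ob C" using Cod_closed[of u] by simp
  obtain S i1 i2 p1 p2 where S: "is_biproduct C (Cod C i) (Dom C j) S i1 i2 p1 p2"
    using biproduct_exists by (metis Cod_closed Dom_closed e'(1) x'(1))
  note b [simp] = biproduct_simps[OF S] biproduct_comp[OF S]
  define d where "d = sub (\<alpha> \<cdot> p1) (j \<cdot> p2)"
  have d [simp]: "d \<in> Arr C" "Dom C d = S" "Cod C d = Cod C j" by (auto simp: d_def)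
  have di: "d \<cdot> i1 = \<alpha>" "d \<cdot> i2 = neg j" by (simp_all add: d_def)
  have "is_epi C d"
  proof (rule is_epiI)
    fix s assume s: "s \<in> Arr C" "Dom C s = Cod C d" "s \<cdot> d = Null C (Dom C d) (Cod C s)"
    have "s \<cdot> \<alpha> = (s \<cdot> d) \<cdot> i1" using s(1,2) di by simp
    then have 1: "s \<cdot> \<alpha> = Null C (Cod C i) (Cod C s)" using s by simp
    have "neg (s \<cdot> j) = (s \<cdot> d) \<cdot> i2" using s(1,2) di by simp
    then have "neg (s \<cdot> j) = Null C (Dom C j) (Cod C s)" using s by simp
    then have 2: "s \<cdot> j = Null C (Dom C j) (Cod C s)"
      using neg_neg[of "s \<cdot> j"] s by simp
    show "s = Null C (Dom C s) (Cod C s)"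
      using extension_jointly_epi[OF e x, of \<alpha> s "Cod C s"] 1 2 s \<alpha> by simp
  qed simp
  moreover obtain k where k: "is_kernel C k d" using kernel_exists d by blast
  ultimately have c: "is_cokernel C d k" by (rule epi_is_cokernel)
  note k' [simp] = kernel_simps[OF k]
  define h where "h = sub (u \<cdot> p1) (v \<cdot> p2)"
  have h [simp]: "h \<in> Arr C" "Dom C h = S" "Cod C h = T" by (auto simp: h_def)
  define a where "a = p1 \<cdot> k"
  define a' where "a' = p2 \<cdot> k"
  have [simp]: "a \<in> Arr C" "Dom C a = Dom C k" "Cod C a = Cod C i"
    "a' \<in> Arr C" "Dom C a' = Dom C k" "Cod C a' = Dom C j" by (auto simp: a_def a'_def)
  have "sub (\<alpha> \<cdot> a) (j \<cdot> a') = d \<cdot> k"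
    by (simp add: d_def a_def a'_def del: k'(4))
  then have aa': "\<alpha> \<cdot> a = j \<cdot> a'"
    using sub_eq_Null[of "\<alpha> \<cdot> a" "j \<cdot> a'" "Dom C k" "Cod C j"] by simp
  have "p \<cdot> a = q \<cdot> (j \<cdot> a')" using comp_eq[OF \<alpha>(3), of a] aa' by simp
  also have "\<dots> = Null C (Dom C a) (Cod C p)" using comp_eq[OF x'(4), of a'] by simp
  finally obtain m where m: "m \<in> Arr C" "Dom C m = Dom C k" "Cod C m = Dom C i" "i \<cdot> m = a"
    using kernel_lift[OF e'(7), of a] by auto
  have "j \<cdot> a' = j \<cdot> (f \<cdot> m)" using comp_square[OF \<alpha>(2), of m] m aa' by simp
  then have "a' = f \<cdot> m" by (rule is_monoD[OF x'(5)]) (use m in auto)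
  then have "v \<cdot> a' = u \<cdot> a" using comp_square[OF uv, of m] m by simp
  then have "h \<cdot> k = Null C (Dom C k) T" by (simp add: h_def flip: a_def a'_def)
  then obtain \<psi> where \<psi>: "\<psi> \<in> Arr C" "Dom C \<psi> = Cod C j" "Cod C \<psi> = T" "\<psi> \<cdot> d = h"
    using cokernel_desc[OF c, of h] by auto
  have "\<psi> \<cdot> \<alpha> = (\<psi> \<cdot> d) \<cdot> i1" using \<psi>(1-3) di by simp
  also have "\<dots> = u" using \<psi>(4) by (simp add: h_def)
  finally have 1: "\<psi> \<cdot> \<alpha> = u" .
  have "neg (\<psi> \<cdot> j) = (\<psi> \<cdot> d) \<cdot> i2" using \<psi>(1-3) di by simp
  also have "\<dots> = neg v" using \<psi>(4) by (simp add: h_def)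
  finally have "\<psi> \<cdot> j = v" using neg_neg[of "\<psi> \<cdot> j"] \<psi>(1-3) by simp
  then show ?thesis using that 1 \<psi> by auto
qed

text \<open>Dual to \<open>extension_pushout\<close>: the right square of a morphism that is the
  identity on the kernel object is a pullback. Now \<open>d\<close>, with components
  \<open>\<psi>\<close> and \<open>- q\<close>, is mono and thus the kernel of its cokernel.\<close>

lemma extension_pullback:
  assumes x: "short_exact C j q" and e: "short_exact C i p"
    and g: "g \<in> Hom C (Cod C q) (Cod C p)"
    and \<psi>: "\<psi> \<in> Hom C (Cod C j) (Cod C i)" "\<psi> \<cdot> j = i" "p \<cdot> \<psi> = g \<cdot> q"
    and u: "u \<in> Hom C T (Cod C i)" and v: "v \<in> Hom C T (Cod C q)" and uv: "p \<cdot> u = g \<cdot> v"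
  obtains w where "w \<in> Hom C T (Cod C j)" "\<psi> \<cdot> w = u" "q \<cdot> w = v"
proof -
  note e' = short_exact_simps[OF e] and x' = short_exact_simps[OF x]
  note [simp] = e'(1-3) x'(1-3)
  have [simp]: "g \<in> Arr C" "Dom C g = Cod C q" "Cod C g = Cod C p"
    "\<psi> \<in> Arr C" "Dom C \<psi> = Cod C j" "Cod C \<psi> = Cod C i" "u \<in> Arr C" "v \<in> Arr C"
    "Dom C u = T" "Cod C u = Cod C i" "Dom C v = T" "Cod C v = Cod C q" "Dom C i = Dom C j"
    using g \<psi> u v by auto
  have T [simp]: "T \<in> Ob C" using Dom_closed[of u] by simp
  obtain S i1 i2 p1 p2 where S: "is_biproduct C (Cod C i) (Cod C q) S i1 i2 p1 p2"
    using biproduct_exists by (metis Cod_closed Dom_closed e'(1) x'(2))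
  note b [simp] = biproduct_simps[OF S] biproduct_comp[OF S]
  define d where "d = sub (i1 \<cdot> \<psi>) (i2 \<cdot> q)"
  have d [simp]: "d \<in> Arr C" "Cod C d = S" "Dom C d = Cod C j" by (auto simp: d_def)
  have di: "p1 \<cdot> d = \<psi>" "p2 \<cdot> d = neg q" by (simp_all add: d_def)
  have "is_mono C d"
  proof (rule is_monoI)
    fix s assume s: "s \<in> Arr C" "Cod C s = Dom C d" "d \<cdot> s = Null C (Dom C s) (Cod C d)"
    have "\<psi> \<cdot> s = p1 \<cdot> (d \<cdot> s)" using s(1,2) comp_eq[OF di(1), of s] by simp
    then have 1: "\<psi> \<cdot> s = Null C (Dom C s) (Cod C i)" using s by simp
    have "neg (q \<cdot> s) = p2 \<cdot> (d \<cdot> s)" using s(1,2) comp_eq[OF di(2), of s] by simp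
    then have "neg (q \<cdot> s) = Null C (Dom C s) (Cod C q)" using s by simp
    then have 2: "q \<cdot> s = Null C (Dom C s) (Cod C q)"
      using neg_neg[of "q \<cdot> s"] s by simp
    show "s = Null C (Dom C s) (Cod C s)"
      using extension_jointly_mono[OF x e, of \<psi> s "Dom C s"] 1 2 s \<psi> by simp
  qed simp
  moreover obtain c where c: "is_cokernel C c d" using cokernel_exists d by blast
  ultimately have k: "is_kernel C d c" by (rule mono_is_kernel)
  note c' [simp] = cokernel_simps[OF c]
  define h where "h = sub (i1 \<cdot> u) (i2 \<cdot> v)"
  have h [simp]: "h \<in> Arr C" "Dom C h = T" "Cod C h = S" by (auto simp: h_def)
  define a where "a = c \<cdot> i1"
  define a' where "a' = c \<cdot> i2"
  have [simp]: "a \<in> Arr C" "Dom C a = Cod C i" "Cod C a = Cod C c"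
    "a' \<in> Arr C" "Dom C a' = Cod C q" "Cod C a' = Cod C c" by (auto simp: a_def a'_def)
  have ac: "c \<cdot> (i1 \<cdot> y) = a \<cdot> y" if "y \<in> Arr C" "Cod C y = Cod C i" for y
    using that by (simp add: a_def)
  have ac': "c \<cdot> (i2 \<cdot> y) = a' \<cdot> y" if "y \<in> Arr C" "Cod C y = Cod C q" for y
    using that by (simp add: a'_def)
  have "sub (a \<cdot> \<psi>) (a' \<cdot> q) = c \<cdot> d"
    by (simp add: d_def ac ac' del: c'(4))
  then have aa': "a \<cdot> \<psi> = a' \<cdot> q"
    using sub_eq_Null[of "a \<cdot> \<psi>" "a' \<cdot> q" "Cod C j" "Cod C c"] by simp
  \<comment> \<open>The component \<open>a\<close> of the cokernel kills \<open>i\<close>, so it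
    factors through \<open>p\<close> as \<open>m \<cdot> p\<close>. Cancelling \<open>q\<close>
    gives \<open>a' = m \<cdot> g\<close>, and \<open>p \<cdot> u = g \<cdot> v\<close> finishes the
    computation.\<close>
  have "a \<cdot> i = (a \<cdot> \<psi>) \<cdot> j" using \<psi>(2) by simp
  also have "\<dots> = a' \<cdot> (q \<cdot> j)" using aa' by simp
  also have "\<dots> = Null C (Dom C i) (Cod C a)" using x'(4) by simp
  finally obtain m where m: "m \<in> Arr C" "Dom C m = Cod C p" "Cod C m = Cod C c" "m \<cdot> p = a"
    using cokernel_desc[OF e'(8), of a] by auto
  have "a' \<cdot> q = (m \<cdot> p) \<cdot> \<psi>" using m(4) aa' by simp
  also have "\<dots> = (m \<cdot> g) \<cdot> q" using m(1-3) \<psi>(3) by simp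
  finally have "a' = m \<cdot> g" by (rule is_epiD[OF x'(6)]) (use m in auto)
  then have "a' \<cdot> v = m \<cdot> (p \<cdot> u)" using m(1-3) uv by simp
  also have "\<dots> = a \<cdot> u" using comp_assoc[of u p m] m by simp
  finally have "c \<cdot> h = Null C T (Cod C c)" by (simp add: h_def ac ac')
  then obtain w where w: "w \<in> Arr C" "Dom C w = T" "Cod C w = Cod C j" "d \<cdot> w = h"
    using kernel_lift[OF k, of h] by auto
  have "\<psi> \<cdot> w = p1 \<cdot> (d \<cdot> w)" using w(1-3) comp_eq[OF di(1), of w] by simp
  also have "\<dots> = u" using w(4) by (simp add: h_def)
  finally have 1: "\<psi> \<cdot> w = u" .
  have "neg (q \<cdot> w) = p2 \<cdot> (d \<cdot> w)" using w(1-3) comp_eq[OF di(2), of w] by simp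
  also have "\<dots> = neg v" using w(4) by (simp add: h_def)
  finally have "q \<cdot> w = v" using neg_neg[of "q \<cdot> w"] w(1-3) by simp
  then show ?thesis using that 1 w by auto
qed

text \<open>The pushout is formed as the cokernel of the arrow with components \<open>i\<close> and
  \<open>- f\<close>. It supplies a member of \<open>delta C (i, p) f\<close>.\<close>

lemma extension_pushout_exists:
  assumes e: "short_exact C i p" and f: "f \<in> Hom C (Dom C i) N"
  obtains j q \<alpha> where "short_exact C j q" "Dom C j = N" "Cod C q = Cod C p"
    "\<alpha> \<in> Hom C (Cod C i) (Cod C j)" "\<alpha> \<cdot> i = j \<cdot> f" "q \<cdot> \<alpha> = p"
proof -
  note e' = short_exact_simps[OF e]
  note [simp] = e'(1-3)
  have [simp]: "f \<in> Arr C" "Dom C f = Dom C i" "Cod C f = N" using f by auto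
  have N [simp]: "N \<in> Ob C" using Cod_closed[of f] by simp
  obtain S i1 i2 p1 p2 where S: "is_biproduct C (Cod C i) N S i1 i2 p1 p2"
    using biproduct_exists by (metis Cod_closed N e'(1))
  note b [simp] = biproduct_simps[OF S] biproduct_comp[OF S]
  define d where "d = sub (i1 \<cdot> i) (i2 \<cdot> f)"
  have d [simp]: "d \<in> Arr C" "Dom C d = Dom C i" "Cod C d = S" by (auto simp: d_def)
  have pd: "p1 \<cdot> d = i" "p2 \<cdot> d = neg f" by (simp_all add: d_def)
  have d_mono: "is_mono C d"
  proof (rule is_monoI)
    fix s assume s: "s \<in> Arr C" "Cod C s = Dom C d" "d \<cdot> s = Null C (Dom C s) (Cod C d)"
    have "i \<cdot> s = p1 \<cdot> (d \<cdot> s)" using s(1,2) comp_eq[OF pd(1), of s] by simp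
    also have "\<dots> = i \<cdot> Null C (Dom C s) (Cod C s)" using s by simp
    finally show "s = Null C (Dom C s) (Cod C s)"
      by (rule is_monoD[OF e'(5)]) (use s in auto)
  qed simp
  obtain c where c: "is_cokernel C c d" using cokernel_exists d by blast
  note c' [simp] = cokernel_simps[OF c]
  have k: "is_kernel C d c" using d_mono c by (rule mono_is_kernel)
  define j where "j = c \<cdot> i2"
  define \<alpha> where "\<alpha> = c \<cdot> i1"
  have [simp]: "j \<in> Arr C" "Dom C j = N" "Cod C j = Cod C c"
    "\<alpha> \<in> Arr C" "Dom C \<alpha> = Cod C i" "Cod C \<alpha> = Cod C c"
    by (auto simp: j_def \<alpha>_def)
  have "sub (\<alpha> \<cdot> i) (j \<cdot> f) = c \<cdot> d" by (simp add: \<alpha>_def j_def d_def del: c'(4))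
  then have sq: "\<alpha> \<cdot> i = j \<cdot> f"
    using sub_eq_Null[of "\<alpha> \<cdot> i" "j \<cdot> f" "Dom C i" "Cod C c"] by simp
  have "(p \<cdot> p1) \<cdot> d = Null C (Dom C d) (Cod C p)" using pd e'(4) by simp
  then obtain q where q: "q \<in> Arr C" "Dom C q = Cod C c" "Cod C q = Cod C p" "q \<cdot> c = p \<cdot> p1"
    using cokernel_desc[OF c, of "p \<cdot> p1"] by auto
  have "q \<cdot> \<alpha> = (q \<cdot> c) \<cdot> i1" using q(1-3) by (simp add: \<alpha>_def)
  also have "\<dots> = p" using q(4) by simp
  finally have q\<alpha>: "q \<cdot> \<alpha> = p" .
  have "q \<cdot> j = (q \<cdot> c) \<cdot> i2" using q(1-3) by (simp add: j_def)
  also have "\<dots> = Null C N (Cod C p)" using q(4) by simp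
  finally have qj: "q \<cdot> j = Null C N (Cod C p)" .
  have j_mono: "is_mono C j"
  proof (rule is_monoI)
    fix s assume s: "s \<in> Arr C" "Cod C s = Dom C j" "j \<cdot> s = Null C (Dom C s) (Cod C j)"
    \<comment> \<open>The pair (0, s) lies in the kernel of \<open>c\<close>, which is
      \<open>d\<close>. Its first component shows that the lift \<open>m\<close> is zero, and then
      its second component \<open>s\<close> is zero too.\<close>
    then have "c \<cdot> (i2 \<cdot> s) = Null C (Dom C s) (Cod C c)" by (simp add: j_def)
    then obtain m where m: "m \<in> Arr C" "Dom C m = Dom C s" "Cod C m = Dom C i" "d \<cdot> m = i2 \<cdot> s"
      using kernel_lift[OF k, of "i2 \<cdot> s"] s by auto
    have "i \<cdot> m = p1 \<cdot> (d \<cdot> m)" using m(1-3) comp_eq[OF pd(1), of m] by simp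
    also have "\<dots> = i \<cdot> Null C (Dom C s) (Dom C i)" using m(4) s by simp
    finally have "m = Null C (Dom C s) (Dom C i)"
      by (rule is_monoD[OF e'(5)]) (use s m in auto)
    then have "i2 \<cdot> s = Null C (Dom C s) S" using m s by simp
    then have "p2 \<cdot> (i2 \<cdot> s) = Null C (Dom C s) N" using s by simp
    then show "s = Null C (Dom C s) (Cod C s)" using s by simp
  qed simp
  have "is_cokernel C q j"
  proof (rule is_cokernelI)
    show "is_epi C q"
    proof (rule is_epiI)
      fix s assume s: "s \<in> Arr C" "Dom C s = Cod C q" "s \<cdot> q = Null C (Dom C q) (Cod C s)"
      have "s \<cdot> p = (s \<cdot> q) \<cdot> \<alpha>" using s(1,2) q q\<alpha> by simp
      also have "\<dots> = Null C (Dom C s) (Cod C s) \<cdot> p" using s q by simp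
      finally show "s = Null C (Dom C s) (Cod C s)"
        by (rule is_epiD[OF e'(6)]) (use s q in auto)
    qed (use q in simp)
    fix h assume h: "h \<in> Arr C" "Dom C h = Cod C j" "h \<cdot> j = Null C (Dom C j) (Cod C h)"
    have "(h \<cdot> \<alpha>) \<cdot> i = (h \<cdot> j) \<cdot> f" using h(1,2) sq by simp
    also have "\<dots> = Null C (Dom C i) (Cod C h)" using h by simp
    finally obtain s where s: "s \<in> Arr C" "Dom C s = Cod C p" "Cod C s = Cod C h" "s \<cdot> p = h \<cdot> \<alpha>"
      using cokernel_desc[OF e'(8), of "h \<cdot> \<alpha>"] h by auto
    have "(s \<cdot> q) \<cdot> c = s \<cdot> (p \<cdot> p1)" using s(1-3) q by simp
    also have "\<dots> = (h \<cdot> \<alpha>) \<cdot> p1" using s comp_assoc[of p1 p s] by simp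
    also have "\<dots> = h \<cdot> c \<cdot> i1 \<cdot> p1" using h by (simp add: \<alpha>_def)
    \<comment> \<open>The added term is zero because \<open>h\<close> kills \<open>j\<close>; with
      it the biproduct decomposition reassembles \<open>h \<cdot> c\<close>.\<close>
    also have "\<dots> = Plus C (h \<cdot> c \<cdot> i1 \<cdot> p1) (h \<cdot> c \<cdot> i2 \<cdot> p2)"
    proof -
      have "h \<cdot> c \<cdot> i2 \<cdot> p2 = (h \<cdot> j) \<cdot> p2" using h(1,2) by (simp add: j_def)
      then have "h \<cdot> c \<cdot> i2 \<cdot> p2 = Null C S (Cod C h)" using h by simp
      then show ?thesis using h(1,2) by simp
    qed
    also have "\<dots> = h \<cdot> c" using biproduct_decomp(1)[OF S, of "h \<cdot> c"] h(1,2) by simp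
    finally have "s \<cdot> q = h" by (rule is_epiD[OF cokernel_epi[OF c]]) (use s h q in auto)
    then show "\<exists>u \<in> Hom C (Cod C q) (Cod C h). u \<cdot> q = h" using s q by auto
  qed (use q qj in auto)
  then have "short_exact C j q"
    using mono_is_kernel[OF j_mono] by (simp add: short_exact_def)
  then show ?thesis using that[of j q \<alpha>] q sq q\<alpha> by simp
qed

text \<open>Both classes consist of the middle rows of the factorisations of \<open>(f, \<phi>, g)\<close> through an
  extension with kernel \<open>Dom C i'\<close> and quotient \<open>Cod C p\<close>.\<close>

lemma delta_eq_partial:
  assumes e: "short_exact C i p" and e': "short_exact C i' p'"
    and f: "f \<in> Hom C (Dom C i) (Dom C i')" and g: "g \<in> Hom C (Cod C p) (Cod C p')"
    and \<phi>: "\<phi> \<in> Hom C (Cod C i) (Cod C i')" "\<phi> \<cdot> i = i' \<cdot> f" "p' \<cdot> \<phi> = g \<cdot> p"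
  shows "delta C (i, p) f = partial C (i', p') g"
proof -
  note s = short_exact_simps[OF e] short_exact_simps[OF e']
  have "(j, q) \<in> delta C (i, p) f \<longleftrightarrow> (j, q) \<in> partial C (i', p') g" for j q
  proof
    assume "(j, q) \<in> delta C (i, p) f"
    then obtain \<alpha> where x: "short_exact C j q" "Dom C j = Dom C i'" "Cod C q = Cod C p"
      and \<alpha>: "\<alpha> \<in> Hom C (Cod C i) (Cod C j)" "\<alpha> \<cdot> i = j \<cdot> f" "q \<cdot> \<alpha> = p"
      using mem_delta[OF e f] by auto
    note x' = short_exact_simps[OF x(1)]
    obtain \<psi> where \<psi>: "\<psi> \<in> Hom C (Cod C j) (Cod C i')" "\<psi> \<cdot> \<alpha> = \<phi>" "\<psi> \<cdot> j = i'"
      using extension_pushout[OF e x(1), of f \<alpha> \<phi> "Cod C i'" i'] f x \<alpha> \<phi> s by auto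
    \<comment> \<open>\<open>\<psi>\<close> was built from its values on \<open>\<alpha>\<close> and
      \<open>j\<close>. These are jointly epi, so the right square also need only be checked on
      them.\<close>
    have "sub (p' \<cdot> \<psi>) (g \<cdot> q) = Null C (Cod C j) (Cod C p')"
    proof (rule extension_jointly_epi[OF e x(1) \<alpha>(1,3)])
      have "sub (p' \<cdot> \<psi>) (g \<cdot> q) \<cdot> \<alpha> = sub (p' \<cdot> \<phi>) (g \<cdot> p)"
        using \<psi> \<alpha> s x' g x by simp
      then show "sub (p' \<cdot> \<psi>) (g \<cdot> q) \<cdot> \<alpha> = Null C (Cod C i) (Cod C p')"
        using \<phi> g s by simp
      show "sub (p' \<cdot> \<psi>) (g \<cdot> q) \<cdot> j = Null C (Dom C j) (Cod C p')"
        using \<psi> s x' g x by simp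
    qed (use \<psi> s x x' g in auto)
    then have "p' \<cdot> \<psi> = g \<cdot> q"
      by (rule sub_eq_Null) (use \<psi> s x x' g in auto)
    then show "(j, q) \<in> partial C (i', p') g" using x \<psi> by (subst mem_partial[OF e' g]) auto
  next
    assume "(j, q) \<in> partial C (i', p') g"
    then obtain \<psi> where x: "short_exact C j q" "Dom C j = Dom C i'" "Cod C q = Cod C p"
      and \<psi>: "\<psi> \<in> Hom C (Cod C j) (Cod C i')" "\<psi> \<cdot> j = i'" "p' \<cdot> \<psi> = g \<cdot> q"
      using mem_partial[OF e' g] by auto
    note x' = short_exact_simps[OF x(1)]
    obtain \<alpha> where \<alpha>: "\<alpha> \<in> Hom C (Cod C i) (Cod C j)" "\<psi> \<cdot> \<alpha> = \<phi>" "q \<cdot> \<alpha> = p"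
      using extension_pullback[OF x(1) e', of g \<psi> \<phi> "Cod C i" p] g x \<psi> \<phi> s by auto
    have "sub (\<alpha> \<cdot> i) (j \<cdot> f) = Null C (Dom C i) (Cod C j)"
    proof (rule extension_jointly_mono[OF x(1) e' \<psi>(1,2)])
      have "\<psi> \<cdot> sub (\<alpha> \<cdot> i) (j \<cdot> f) = sub (\<phi> \<cdot> i) (i' \<cdot> f)"
        using \<psi>(1) \<alpha>(1) s x' f x comp_eq[OF \<psi>(2), of f] comp_eq[OF \<alpha>(2), of i] by simp
      then show "\<psi> \<cdot> sub (\<alpha> \<cdot> i) (j \<cdot> f) = Null C (Dom C i) (Cod C i')"
        using \<phi> f s by simp
      show "q \<cdot> sub (\<alpha> \<cdot> i) (j \<cdot> f) = Null C (Dom C i) (Cod C q)"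
        using \<alpha>(1) s x' f x comp_eq[OF x'(4), of f] comp_eq[OF \<alpha>(3), of i] by simp
    qed (use \<alpha> s x x' f in auto)
    then have "\<alpha> \<cdot> i = j \<cdot> f"
      by (rule sub_eq_Null) (use \<alpha> s x x' f in auto)
    then show "(j, q) \<in> delta C (i, p) f" using x \<alpha> by (subst mem_delta[OF e f]) auto
  qed
  then show ?thesis by auto
qed

section \<open>Chosen kernels and the image of a differential\<close>

lemma ker_is_kernel: "f \<in> Arr C \<Longrightarrow> is_kernel C (ker C f) f"
  unfolding ker_def using kernel_exists by (rule someI_ex)

lemma coker_is_cokernel: "f \<in> Arr C \<Longrightarrow> is_cokernel C (coker C f) f"
  unfolding coker_def using cokernel_exists by (rule someI_ex)

text \<open>Used to see that a differential of an exact complex maps onto the next kernel. If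
  \<open>t\<close> kills \<open>b\<close>, then \<open>k \<cdot> b\<close> factors through
  \<open>k \<cdot> s\<close> with \<open>s\<close> the kernel of \<open>t\<close>. The cokernel of
  \<open>k \<cdot> s\<close> then factors through \<open>c\<close>, so it kills \<open>k\<close>,
  and \<open>k\<close> itself factors through \<open>k \<cdot> s\<close>. Hence \<open>s\<close> has
  a right inverse and \<open>t\<close> is zero.\<close>

lemma epi_onto_image:
  assumes k: "is_mono C k" and b: "b \<in> Arr C" "Cod C b = Dom C k"
    and c: "is_cokernel C c (k \<cdot> b)" "c \<cdot> k = Null C (Dom C k) (Cod C c)"
  shows "is_epi C b"
proof (rule is_epiI)
  have k': "k \<in> Arr C" using k by (simp add: is_mono_def)
  note c' = cokernel_simps[OF c(1)]
  fix t assume t: "t \<in> Arr C" "Dom C t = Cod C b" "t \<cdot> b = Null C (Dom C b) (Cod C t)"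
  obtain s where s: "is_kernel C s t" using kernel_exists t(1) by blast
  note s' = kernel_simps[OF s]
  obtain b' where b': "b' \<in> Arr C" "Dom C b' = Dom C b" "Cod C b' = Dom C s" "s \<cdot> b' = b"
    using kernel_lift[OF s, of b] b t by auto
  have ks: "is_mono C (k \<cdot> s)" using is_mono_comp[OF kernel_mono[OF s] k] s' b t by simp
  have [simp]: "k \<cdot> s \<in> Arr C" "Dom C (k \<cdot> s) = Dom C s" "Cod C (k \<cdot> s) = Cod C k"
    using k' s' b t by auto
  obtain d where d: "is_cokernel C d (k \<cdot> s)" using cokernel_exists[of "k \<cdot> s"] by auto
  note d' = cokernel_simps[OF d]
  have "d \<cdot> (k \<cdot> b) = (d \<cdot> (k \<cdot> s)) \<cdot> b'" using d'(1-3) k' s' b b' t by simp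
  also have "\<dots> = Null C (Dom C (k \<cdot> b)) (Cod C d)" unfolding d'(4) using d'(1-3) k' b b' by simp
  finally obtain v where v: "v \<in> Arr C" "Dom C v = Cod C c" "Cod C v = Cod C d" "v \<cdot> c = d"
    using cokernel_desc[OF c(1), of d] d' k' b by auto
  have "d \<cdot> k = v \<cdot> (c \<cdot> k)" using v comp_assoc[of k c v] c' k' b by simp
  also have "\<dots> = Null C (Dom C k) (Cod C d)" using v c k' by simp
  finally obtain w where w: "w \<in> Arr C" "Dom C w = Dom C k" "Cod C w = Dom C s" "(k \<cdot> s) \<cdot> w = k"
    using kernel_lift[OF mono_is_kernel[OF ks d], of k] d' k' by auto
  have "k \<cdot> (s \<cdot> w) = k \<cdot> Ide C (Dom C k)" using w k' s' b t by simp
  then have sw: "s \<cdot> w = Ide C (Dom C k)" by (rule is_monoD[OF k]) (use w k' s' b t in auto)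
  have "t = t \<cdot> (s \<cdot> w)" using sw b t by simp
  also have "\<dots> = Null C (Dom C t) (Cod C t)" using comp_eq[OF s'(4), of w] w s' b t by simp
  finally show "t = Null C (Dom C t) (Cod C t)" .
qed (rule b)

end

section \<open>The stable Hom groups and their transition maps\<close>

locale abelian_with_subcategory = abelian_category +
  fixes V
  assumes V: "additive_subcategory C V"
begin

section \<open>Arrows that factor through V and Hom modulo them\<close>

lemma V_Ob: "W \<in> V \<Longrightarrow> W \<in> Ob C"
  using V by (auto simp: additive_subcategory_def)

lemma zero_in_V: obtains Z where "Z \<in> V" "is_zero_object C Z"
  using V by (auto simp: additive_subcategory_def)

lemma biproduct_in_V:
  assumes "A \<in> V" "B \<in> V"
  obtains S i j p q where "S \<in> V" "is_biproduct C A B S i j p q"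
  using V assms unfolding additive_subcategory_def by meson

lemma factoringI:
  assumes "g \<in> Hom C A W" "h \<in> Hom C W B" "W \<in> V" "f = h \<cdot> g"
  shows "f \<in> factoring C V A B"
proof -
  have "f \<in> Hom C A B" using assms by auto
  then show ?thesis using assms unfolding factoring_def by blast
qed

lemma factoringD:
  assumes "f \<in> factoring C V A B"
  obtains W g h where "W \<in> V" "g \<in> Hom C A W" "h \<in> Hom C W B" "f = h \<cdot> g"
  using assms unfolding factoring_def by blast

lemma factoring_simps:
  assumes "f \<in> factoring C V A B"
  shows "f \<in> Arr C" "Dom C f = A" "Cod C f = B"
  using assms unfolding factoring_def by auto

lemma factoring_Null:
  assumes "A \<in> Ob C" "B \<in> Ob C"
  shows "Null C A B \<in> factoring C V A B"
proof -
  obtain Z where "Z \<in> V" using zero_in_V .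
  then show ?thesis
    using assms V_Ob by (intro factoringI[of "Null C A Z" A Z "Null C Z B"]) auto
qed

lemma factoring_neg:
  assumes "f \<in> factoring C V A B"
  shows "neg f \<in> factoring C V A B"
proof -
  obtain W g h where "W \<in> V" "g \<in> Hom C A W" "h \<in> Hom C W B" "f = h \<cdot> g"
    using assms by (rule factoringD)
  then show ?thesis by (intro factoringI[of g A W "neg h"]) auto
qed

lemma factoring_Plus:
  assumes "f \<in> factoring C V A B" "f' \<in> factoring C V A B"
  shows "Plus C f f' \<in> factoring C V A B"
proof -
  obtain W g h where f: "W \<in> V" "g \<in> Hom C A W" "h \<in> Hom C W B" "f = h \<cdot> g"
    using assms(1) by (rule factoringD)
  obtain W' g' h' where f': "W' \<in> V" "g' \<in> Hom C A W'" "h' \<in> Hom C W' B" "f' = h' \<cdot> g'"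
    using assms(2) by (rule factoringD)
  obtain S i j p q where S: "S \<in> V" "is_biproduct C W W' S i j p q"
    using biproduct_in_V f f' by metis
  note b = biproduct_simps[OF S(2)] biproduct_comp[OF S(2)]
  have A: "A \<in> Ob C" "B \<in> Ob C" using f by auto
  show ?thesis
  \<comment> \<open>The sum factors through the biproduct of the two intermediate objects, again in
    V.\<close>
  proof (rule factoringI[of "Plus C (i \<cdot> g) (j \<cdot> g')" A S "Plus C (h \<cdot> p) (h' \<cdot> q)"])
    show "Plus C f f' = Plus C (h \<cdot> p) (h' \<cdot> q) \<cdot> Plus C (i \<cdot> g) (j \<cdot> g')"
      using f f' b A by simp
  qed (use f f' b S in auto)
qed

lemma factoring_comp_left:
  assumes "f \<in> factoring C V A B" "g \<in> Hom C B D"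
  shows "g \<cdot> f \<in> factoring C V A D"
proof -
  obtain W k h where "W \<in> V" "k \<in> Hom C A W" "h \<in> Hom C W B" "f = h \<cdot> k"
    using assms(1) by (rule factoringD)
  then show ?thesis using assms by (intro factoringI[of k A W "g \<cdot> h"]) auto
qed

lemma factoring_comp_right:
  assumes "f \<in> factoring C V A B" "g \<in> Hom C D A"
  shows "f \<cdot> g \<in> factoring C V D B"
proof -
  obtain W k h where "W \<in> V" "k \<in> Hom C A W" "h \<in> Hom C W B" "f = h \<cdot> k"
    using assms(1) by (rule factoringD)
  then show ?thesis using assms by (intro factoringI[of "k \<cdot> g" D W h]) auto
qed

lemma factoring_subgroup:
  assumes "A \<in> Ob C" "B \<in> Ob C"
  shows "subgroup (factoring C V A B) (Hom_group C A B)"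
proof -
  interpret G: comm_group "Hom_group C A B" using Hom_comm_group assms .
  show ?thesis
  proof (rule G.subgroupI)
    fix a assume a: "a \<in> factoring C V A B"
    show "inv\<^bsub>Hom_group C A B\<^esub> a \<in> factoring C V A B"
      using factoring_neg[OF a] factoring_simps[OF a] by (simp add: neg_def)
  qed (use factoring_simps factoring_Null[OF assms] factoring_Plus in auto)
qed

lemma Hom_bar_group:
  assumes "A \<in> Ob C" "B \<in> Ob C"
  shows "group (Hom_bar C V A B)"
proof -
  interpret G: comm_group "Hom_group C A B" using Hom_comm_group assms .
  show ?thesis unfolding Hom_bar_def
    using G.subgroup_imp_normal[OF factoring_subgroup[OF assms]] by (rule normal.factorgroup_is_group)
qed

lemma carrier_Hom_bar: "carrier (Hom_bar C V A B) = Hom_proj C V A B ` Hom C A B"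
  by (auto simp: Hom_bar_def carrier_FactGroup Hom_proj_def)

lemma mem_Hom_proj:
  assumes "f \<in> Hom C A B"
  shows "h \<in> Hom_proj C V A B f \<longleftrightarrow> h \<in> Hom C A B \<and> sub h f \<in> factoring C V A B"
proof
  assume "h \<in> Hom_proj C V A B f"
  then obtain k where "k \<in> factoring C V A B" "h = Plus C k f"
    by (auto simp: Hom_proj_def r_coset_def)
  then show "h \<in> Hom C A B \<and> sub h f \<in> factoring C V A B"
    using factoring_simps[of k A B] assms by auto
next
  assume h: "h \<in> Hom C A B \<and> sub h f \<in> factoring C V A B"
  then have "Plus C (sub h f) f = h" using assms by simp
  then show "h \<in> Hom_proj C V A B f"
    using h unfolding Hom_proj_def r_coset_def Hom_group_simps by blast
qed

lemma Hom_proj_self: "f \<in> Hom C A B \<Longrightarrow> f \<in> Hom_proj C V A B f"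
  using factoring_Null[of A B] by (subst mem_Hom_proj) auto

lemma Hom_proj_eq_iff:
  assumes "f \<in> Hom C A B" "g \<in> Hom C A B"
  shows "Hom_proj C V A B f = Hom_proj C V A B g \<longleftrightarrow> sub f g \<in> factoring C V A B"
proof
  assume "Hom_proj C V A B f = Hom_proj C V A B g"
  then show "sub f g \<in> factoring C V A B"
    using Hom_proj_self[OF assms(1)] mem_Hom_proj[OF assms(2)] by auto
next
  have AB: "A \<in> Ob C" "B \<in> Ob C" using assms by auto
  interpret G: comm_group "Hom_group C A B" using Hom_comm_group AB .
  assume "sub f g \<in> factoring C V A B"
  then have "f \<in> Hom_proj C V A B g" using mem_Hom_proj[of g A B f] assms by auto
  then show "Hom_proj C V A B f = Hom_proj C V A B g"
    using G.repr_independence[of f _ g] factoring_subgroup[OF AB] assms by (simp add: Hom_proj_def)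
qed

lemma one_Hom_bar:
  assumes "A \<in> Ob C" "B \<in> Ob C"
  shows "\<one>\<^bsub>Hom_bar C V A B\<^esub> = Hom_proj C V A B (Null C A B)"
proof -
  interpret G: comm_group "Hom_group C A B" using Hom_comm_group assms .
  show ?thesis
    using G.coset_mult_one[of "factoring C V A B"] subgroup.subset[OF factoring_subgroup[OF assms]]
    by (simp add: Hom_bar_def Hom_proj_def)
qed

section \<open>Proper exact sequences and evaluation of the transition maps\<close>

text \<open>These are the short exact sequences that stay exact under Hom into V. That functor is
  left exact, so surjectivity onto the maps from the kernel object is all that must be
  demanded.\<close>

definition proper_exact :: "'b \<Rightarrow> 'b \<Rightarrow> bool" where
  "proper_exact i p \<longleftrightarrow> short_exact C i p \<and>
     (\<forall>W \<in> V. \<forall>k \<in> Hom C (Dom C i) W. \<exists>k' \<in> Hom C (Cod C i) W. k' \<cdot> i = k)"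

lemma proper_exact_extend:
  assumes "proper_exact i p" "k \<in> Hom C (Dom C i) W" "W \<in> V"
  obtains k' where "k' \<in> Arr C" "Dom C k' = Cod C i" "Cod C k' = W" "k' \<cdot> i = k"
proof -
  have "\<exists>k' \<in> Hom C (Cod C i) W. k' \<cdot> i = k" using assms unfolding proper_exact_def by blast
  then show ?thesis using that by auto
qed

text \<open>One step of the comparison theorem: \<open>i' \<cdot> f\<close> ends in an object of V
  and so extends along \<open>i\<close>; the extension then induces the arrow on cokernels.\<close>

lemma proper_exact_morphism:
  assumes e: "proper_exact i p" and e': "short_exact C i' p'" "Cod C i' \<in> V"
    and f: "f \<in> Hom C (Dom C i) (Dom C i')"
  obtains \<phi> g where "\<phi> \<in> Hom C (Cod C i) (Cod C i')" "g \<in> Hom C (Cod C p) (Cod C p')"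
    "\<phi> \<cdot> i = i' \<cdot> f" "p' \<cdot> \<phi> = g \<cdot> p"
proof -
  have se: "short_exact C i p" using e by (simp add: proper_exact_def)
  note s = short_exact_simps[OF se] short_exact_simps[OF e'(1)]
  obtain \<phi> where \<phi>: "\<phi> \<in> Arr C" "Dom C \<phi> = Cod C i" "Cod C \<phi> = Cod C i'" "\<phi> \<cdot> i = i' \<cdot> f"
    using proper_exact_extend[OF e, of "i' \<cdot> f"] f s e'(2) by auto
  have "(p' \<cdot> \<phi>) \<cdot> i = (p' \<cdot> i') \<cdot> f" using \<phi> s(1-4,9-11) f by simp
  also have "\<dots> = Null C (Dom C i) (Cod C p')" using s f by simp
  finally obtain g where "g \<in> Arr C" "Dom C g = Cod C p" "Cod C g = Cod C p'" "g \<cdot> p = p' \<cdot> \<phi>"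
    using cokernel_desc[OF s(8), of "p' \<cdot> \<phi>"] \<phi> s by auto
  then show ?thesis using that \<phi> by auto
qed

text \<open>If \<open>f\<close> and \<open>f'\<close> differ by \<open>h \<cdot> k\<close> through V
  and \<open>k'\<close> extends \<open>k\<close> along \<open>i\<close>, then subtracting
  \<open>j \<cdot> (h \<cdot> k')\<close> from \<open>\<alpha>\<close> turns a witness for
  \<open>f\<close> into one for \<open>f'\<close>. The projection to the quotient does not notice
  the change, since \<open>q\<close> kills \<open>j\<close>. The hypothesis is symmetric, so one
  inclusion is enough.\<close>

lemma delta_cong:
  assumes e: "proper_exact i p" and f: "f \<in> Hom C (Dom C i) N" "f' \<in> Hom C (Dom C i) N"
    and ff': "sub f f' \<in> factoring C V (Dom C i) N"
  shows "delta C (i, p) f \<subseteq> delta C (i, p) f'"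
proof clarify
  have se: "short_exact C i p" using e by (simp add: proper_exact_def)
  note s = short_exact_simps[OF se]
  fix j q assume "(j, q) \<in> delta C (i, p) f"
  then obtain \<alpha> where x: "short_exact C j q" "Dom C j = N" "Cod C q = Cod C p"
    and \<alpha>: "\<alpha> \<in> Hom C (Cod C i) (Cod C j)" "\<alpha> \<cdot> i = j \<cdot> f" "q \<cdot> \<alpha> = p"
    using mem_delta[OF se f(1)] by auto
  note x' = short_exact_simps[OF x(1)]
  obtain W k h where W: "W \<in> V" "k \<in> Hom C (Dom C i) W" "h \<in> Hom C W N" "sub f f' = h \<cdot> k"
    using ff' by (rule factoringD)
  obtain k' where k': "k' \<in> Arr C" "Dom C k' = Cod C i" "Cod C k' = W" "k' \<cdot> i = k"
    using proper_exact_extend[OF e W(2,1)] .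
  define \<alpha>' where "\<alpha>' = sub \<alpha> (j \<cdot> (h \<cdot> k'))"
  have "\<alpha>' \<cdot> i = sub (j \<cdot> f) (j \<cdot> (h \<cdot> k))"
    using \<alpha> x x' W(1-3) k' s by (simp add: \<alpha>'_def)
  also have "\<dots> = j \<cdot> sub f (sub f f')" using \<alpha> x x' W f by simp
  also have "\<dots> = j \<cdot> f'" using f by simp
  finally have "\<alpha>' \<cdot> i = j \<cdot> f'" .
  moreover have "\<alpha>' \<in> Hom C (Cod C i) (Cod C j)" using \<alpha> x x' W(1-3) k' by (simp add: \<alpha>'_def)
  moreover have "q \<cdot> \<alpha>' = p"
    using \<alpha> x x' W(1-3) k' s comp_eq[OF x'(4), of "h \<cdot> k'"] by (simp add: \<alpha>'_def)
  ultimately show "(j, q) \<in> delta C (i, p) f'"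
    using x by (subst mem_delta[OF se f(2)]) blast
qed

lemma factoring_sub_commute:
  assumes "sub f g \<in> factoring C V A B" "f \<in> Hom C A B" "g \<in> Hom C A B"
  shows "sub g f \<in> factoring C V A B"
  using assms Hom_proj_eq_iff[of f A B g] Hom_proj_eq_iff[of g A B f] by metis

lemma delta_bar_Hom_proj:
  assumes e: "proper_exact i p" and f: "f \<in> Hom C (Dom C i) N"
  shows "delta_bar C (i, p) (Hom_proj C V (Dom C i) N f) = delta C (i, p) f"
proof -
  have "delta C (i, p) h = delta C (i, p) f" if "h \<in> Hom_proj C V (Dom C i) N f" for h
  proof -
    have h: "h \<in> Hom C (Dom C i) N" "sub h f \<in> factoring C V (Dom C i) N"
      using that mem_Hom_proj[OF f] by auto
    show ?thesis
      using delta_cong[OF e h(1) f h(2)] delta_cong[OF e f h(1)] factoring_sub_commute[OF h(2,1) f]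
      by blast
  qed
  then have "delta C (i, p) ` Hom_proj C V (Dom C i) N f = {delta C (i, p) f}"
    using Hom_proj_self[OF f] by blast
  then show ?thesis by (simp add: delta_bar_def)
qed

text \<open>This makes the value of \<open>beta\<close> unambiguous. For a common member
  \<open>(j, q)\<close> the two witnesses agree on \<open>j\<close>, so their difference is
  \<open>t \<cdot> q\<close>, and the two arrows differ by \<open>p \<cdot> t\<close>, which passes
  through \<open>Cod C i\<close>. Nonemptiness provides the common member.\<close>

lemma partial_eq_imp_factoring:
  assumes e: "short_exact C i p" "Cod C i \<in> V"
    and g: "g \<in> Hom C X (Cod C p)" "g' \<in> Hom C X (Cod C p)"
    and eq: "partial C (i, p) g = partial C (i, p) g'" and ne: "partial C (i, p) g \<noteq> {}"
  shows "sub g g' \<in> factoring C V X (Cod C p)"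
proof -
  note s = short_exact_simps[OF e(1)]
  obtain j q where jq: "(j, q) \<in> partial C (i, p) g" "(j, q) \<in> partial C (i, p) g'"
    using ne eq by auto
  obtain \<psi> where x: "short_exact C j q" "Dom C j = Dom C i" "Cod C q = X"
    and \<psi>: "\<psi> \<in> Hom C (Cod C j) (Cod C i)" "\<psi> \<cdot> j = i" "p \<cdot> \<psi> = g \<cdot> q"
    using jq(1) mem_partial[OF e(1) g(1)] by auto
  obtain \<psi>' where \<psi>': "\<psi>' \<in> Hom C (Cod C j) (Cod C i)" "\<psi>' \<cdot> j = i" "p \<cdot> \<psi>' = g' \<cdot> q"
    using jq(2) mem_partial[OF e(1) g(2)] by auto
  note x' = short_exact_simps[OF x(1)]
  have "sub \<psi> \<psi>' \<cdot> j = Null C (Dom C j) (Cod C i)" using \<psi> \<psi>' x' s x by simp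
  then obtain t where t: "t \<in> Arr C" "Dom C t = X" "Cod C t = Cod C i" "t \<cdot> q = sub \<psi> \<psi>'"
    using cokernel_desc[OF x'(8), of "sub \<psi> \<psi>'"] \<psi> \<psi>' x by auto
  have "sub g g' \<cdot> q = p \<cdot> sub \<psi> \<psi>'" using g \<psi> \<psi>' x x' s by simp
  also have "\<dots> = (p \<cdot> t) \<cdot> q" using t x x' s by simp
  finally have "sub g g' = p \<cdot> t" by (rule is_epiD[OF x'(6)]) (use g t x x' s in auto)
  then show ?thesis using t s e by (intro factoringI[of t X "Cod C i" p]) auto
qed

text \<open>The rule by which every later value of \<open>Delta\<close> is computed. All preimages
  of the class under \<open>partial\<close> have the same projection, so the set inside
  \<open>beta\<close> is a singleton.\<close>

lemma Delta_Hom_proj: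
  assumes e: "proper_exact i p" and e': "short_exact C i' p'" "Cod C i' \<in> V"
    and f: "f \<in> Hom C (Dom C i) (Dom C i')" and g: "g \<in> Hom C (Cod C p) (Cod C p')"
    and \<phi>: "\<phi> \<in> Hom C (Cod C i) (Cod C i')" "\<phi> \<cdot> i = i' \<cdot> f" "p' \<cdot> \<phi> = g \<cdot> p"
  shows "Delta C V (i, p) (i', p') (Hom_proj C V (Dom C i) (Dom C i') f) =
    Hom_proj C V (Cod C p) (Cod C p') g"
proof -
  have se: "short_exact C i p" using e by (simp add: proper_exact_def)
  have eq: "delta C (i, p) f = partial C (i', p') g"
    using delta_eq_partial[OF se e'(1) f g \<phi>] .
  obtain j q \<alpha> where "short_exact C j q" "Dom C j = Dom C i'" "Cod C q = Cod C p"
    "\<alpha> \<in> Hom C (Cod C i) (Cod C j)" "\<alpha> \<cdot> i = j \<cdot> f" "q \<cdot> \<alpha> = p"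
    using extension_pushout_exists[OF se f] .
  then have "(j, q) \<in> delta C (i, p) f" using mem_delta[OF se f] by auto
  then have ne: "partial C (i', p') g \<noteq> {}" using eq by auto
  have "Hom_proj C V (Cod C p) (Cod C p') h = Hom_proj C V (Cod C p) (Cod C p') g"
    if "h \<in> Hom C (Cod C p) (Cod C p')" "partial C (i', p') h = partial C (i', p') g" for h
    using partial_eq_imp_factoring[OF e' that(1) g] that ne Hom_proj_eq_iff[OF that(1) g] by simp
  then have "Hom_proj C V (Cod C p) (Cod C p') `
      {h \<in> Hom C (Cod C p) (Cod C p'). partial C (i', p') h = partial C (i', p') g} =
      {Hom_proj C V (Cod C p) (Cod C p') g}"
    using g by blast
  then show ?thesis
    by (simp only: Delta_def delta_bar_Hom_proj[OF e f] beta_def eq fst_conv snd_conv the_elem_eq)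
qed

lemma Delta_closed:
  assumes e: "proper_exact i p" and e': "short_exact C i' p'" "Cod C i' \<in> V"
    and x: "x \<in> carrier (Hom_bar C V (Dom C i) (Dom C i'))"
  shows "Delta C V (i, p) (i', p') x \<in> carrier (Hom_bar C V (Cod C p) (Cod C p'))"
proof -
  obtain f where f: "f \<in> Hom C (Dom C i) (Dom C i')" "x = Hom_proj C V (Dom C i) (Dom C i') f"
    using x carrier_Hom_bar by auto
  obtain \<phi> g where "\<phi> \<in> Hom C (Cod C i) (Cod C i')" and g: "g \<in> Hom C (Cod C p) (Cod C p')"
    and "\<phi> \<cdot> i = i' \<cdot> f" "p' \<cdot> \<phi> = g \<cdot> p"
    using proper_exact_morphism[OF e e' f(1)] .
  then have "Delta C V (i, p) (i', p') x = Hom_proj C V (Cod C p) (Cod C p') g"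
    using Delta_Hom_proj[OF e e' f(1) g] f by simp
  then show ?thesis using g carrier_Hom_bar by blast
qed

lemma Delta_one:
  assumes e: "proper_exact i p" and e': "short_exact C i' p'" "Cod C i' \<in> V"
  shows "Delta C V (i, p) (i', p') \<one>\<^bsub>Hom_bar C V (Dom C i) (Dom C i')\<^esub> =
    \<one>\<^bsub>Hom_bar C V (Cod C p) (Cod C p')\<^esub>"
proof -
  have se: "short_exact C i p" using e by (simp add: proper_exact_def)
  note s = short_exact_simps[OF se] short_exact_simps[OF e'(1)]
  show ?thesis
    using Delta_Hom_proj[OF e e', of "Null C (Dom C i) (Dom C i')" "Null C (Cod C p) (Cod C p')"
        "Null C (Cod C i) (Cod C i')"] s
    by (simp add: one_Hom_bar)
qed

lemma Delta_Ide:
  assumes e: "proper_exact i p" "Cod C i \<in> V"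
  shows "Delta C V (i, p) (i, p) (Hom_proj C V (Dom C i) (Dom C i) (Ide C (Dom C i))) =
    Hom_proj C V (Cod C p) (Cod C p) (Ide C (Cod C p))"
proof -
  have se: "short_exact C i p" using e by (simp add: proper_exact_def)
  note s = short_exact_simps[OF se]
  show ?thesis
    using Delta_Hom_proj[OF e(1) se e(2), of "Ide C (Dom C i)" "Ide C (Cod C p)" "Ide C (Cod C i)"] s
    by simp
qed

section \<open>Coresolutions as spliced proper exact sequences\<close>

lemma proper_exact_simps:
  assumes "proper_exact i p"
  shows "i \<in> Arr C" "p \<in> Arr C" "Dom C p = Cod C i" "p \<cdot> i = Null C (Dom C i) (Cod C p)"
    "is_mono C i" "is_epi C p" "is_kernel C i p" "is_cokernel C p i" "short_exact C i p"
  using assms short_exact_simps[of i p] by (auto simp: proper_exact_def)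

lemma theta_exact:
  assumes I: "proper_coresolution C V M I"
  shows "proper_exact (theta_in C I n) (theta_out C I n)" "Cod C (theta_in C I n) = Term I n"
    "Dom C (theta_in C I n) = theta C M I n" "Cod C (theta_out C I n) = theta C M I (Suc n)"
proof -
  have T: "Term I n \<in> V" for n using I by (simp add: proper_coresolution_def)
  have D [simp]: "Diff I n \<in> Arr C" "Dom C (Diff I n) = Term I n" "Cod C (Diff I n) = Term I (Suc n)" for n
    using I by (auto simp: proper_coresolution_def)
  have A [simp]: "Aug I \<in> Arr C" "Dom C (Aug I) = M" "Cod C (Aug I) = Term I 0"
    using I by (auto simp: proper_coresolution_def)
  \<comment> \<open>At 0 this is the condition on the augmentation, at positive indices the choice
    of kernel; so all degrees can be treated alike.\<close>
  have kin: "is_kernel C (theta_in C I n) (Diff I n)" for n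
    using I ker_is_kernel[of "Diff I n"] by (auto simp: theta_in_def proper_coresolution_def)
  have kin' [simp]: "theta_in C I n \<in> Arr C" "Cod C (theta_in C I n) = Term I n" for n
    using kernel_simps[OF kin[of n]] by auto
  have Dom_in [simp]: "Dom C (theta_in C I n) = theta C M I n" for n
    by (simp add: theta_in_def theta_def)
  have M [simp]: "M \<in> Ob C" using Dom_closed[of "Aug I"] by simp
  have out: "theta_out C I n \<in> Arr C" "Dom C (theta_out C I n) = Term I n"
    "Cod C (theta_out C I n) = theta C M I (Suc n)"
    "theta_in C I (Suc n) \<cdot> theta_out C I n = Diff I n"
    "is_cokernel C (theta_out C I n) (theta_in C I n)" for n
  proof -
    let ?c = "coker C (Diff I n)" and ?m = "image_arr C (Diff I n)"
    let ?k = "ker C (Diff I (Suc n))"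
    have ke: "?k = theta_in C I (Suc n)" by (simp add: theta_in_def)
    have c: "is_cokernel C ?c (Diff I n)" by (rule coker_is_cokernel) simp
    note c' = cokernel_simps[OF c]
    have m: "is_kernel C ?m ?c" unfolding image_arr_def by (rule ker_is_kernel) (rule c')
    have m1: "is_kernel C ?m (Diff I (Suc n))"
      using I by (auto simp: proper_coresolution_def exact_at_def)
    note m' = kernel_simps[OF m] kernel_simps[OF m1]
    have k: "is_kernel C ?k (Diff I (Suc n))" by (rule ker_is_kernel) simp
    note k' = kernel_simps[OF k]
    obtain r where r: "r \<in> Arr C" "Dom C r = Term I n" "Cod C r = Dom C ?m" "?m \<cdot> r = Diff I n"
      using kernel_lift[OF m, of "Diff I n"] c' by auto
    \<comment> \<open>The differential factors through its image, which is a kernel of the next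
      differential. Vanishing of the composite is what makes the arrow described by
      \<open>theta_out\<close> exist.\<close>
    have "Diff I (Suc n) \<cdot> Diff I n = Null C (Term I n) (Term I (Suc (Suc n)))"
      using comp_eq[OF m'(8), of r] r m' Cod_closed[OF D(1), of "Suc n"] by simp
    then have "\<exists>!u. u \<in> Hom C (Term I n) (Dom C ?k) \<and> ?k \<cdot> u = Diff I n"
      using k V_Ob[OF T] unfolding is_kernel_def by auto
    then have "theta_out C I n \<in> Hom C (Term I n) (Dom C ?k) \<and> ?k \<cdot> theta_out C I n = Diff I n"
      unfolding theta_out_def by (rule theI')
    then show o: "theta_out C I n \<in> Arr C" "Dom C (theta_out C I n) = Term I n"
      "Cod C (theta_out C I n) = theta C M I (Suc n)"
      "theta_in C I (Suc n) \<cdot> theta_out C I n = Diff I n"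
      by (auto simp: theta_def theta_in_def)
    obtain w where w: "w \<in> Arr C" "Dom C w = Dom C ?k" "Cod C w = Dom C ?m" "?m \<cdot> w = ?k"
      using kernel_lift[OF m1, of ?k] k' by auto
    \<comment> \<open>By exactness the chosen kernel factors through the image, so the cokernel of
      the differential kills it. This is the last hypothesis of
      \<open>epi_onto_image\<close>.\<close>
    have "?c \<cdot> ?k = Null C (Dom C ?k) (Cod C ?c)"
      using comp_eq[OF m'(4), of w] w m' c' by simp
    then have "is_epi C (theta_out C I n)"
      using epi_onto_image[OF kernel_mono[OF k], of "theta_out C I n" ?c] o c ke by simp
    moreover have "is_kernel C (theta_in C I n) (theta_out C I n)"
      using is_kernel_mono_comp[OF kernel_mono[OF kin[of "Suc n"]], of "theta_out C I n"]
        kin[of n] o by simp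
    ultimately show "is_cokernel C (theta_out C I n) (theta_in C I n)"
      by (rule epi_is_cokernel)
  qed
  have ker: "is_kernel C (theta_in C I n) (theta_out C I n)" for n
    using is_kernel_mono_comp[OF kernel_mono[OF kin[of "Suc n"]], of "theta_out C I n"]
      kin[of n] out[of n] by simp
  have zero: "theta_out C I n \<cdot> theta_in C I n = Null C (theta C M I n) (theta C M I (Suc n))" for n
    using kernel_simps[OF ker[of n]] out[of n] by simp
  have "\<exists>k' \<in> Hom C (Term I n) W. k' \<cdot> theta_in C I n = k"
    if W: "W \<in> V" and k: "k \<in> Hom C (theta C M I n) W" for W k
  proof (cases n)
    case 0
    have "(\<lambda>g. g \<cdot> Aug I) ` Hom C (Term I 0) W = Hom C M W"
      using I W unfolding proper_coresolution_def by blast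
    moreover have "k \<in> Hom C M W" using k 0 by (simp add: theta_def)
    ultimately have "k \<in> (\<lambda>g. g \<cdot> Aug I) ` Hom C (Term I 0) W" by simp
    then show ?thesis using 0 by (auto simp: theta_in_def)
  next
    case (Suc m)
    \<comment> \<open>To extend \<open>k\<close> from the cosyzygy, it is first pulled back to the
      preceding term, where Hom-exactness of the complex provides \<open>g\<close>. The epimorphism
      \<open>theta_out C I m\<close> is cancelled at the end.\<close>
    define f where "f = k \<cdot> theta_out C I m"
    have f: "f \<in> Arr C" "Dom C f = Term I m" "Cod C f = W" using out[of m] k Suc by (auto simp: f_def)
    have "\<exists>g \<in> Hom C (Term I n) W. g \<cdot> Diff I m = f"
    \<comment> \<open>The pulled-back arrow must kill the augmentation if \<open>m\<close> is 0 and
      the preceding differential otherwise.\<close>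
    proof (cases m)
      case 0
      have "f \<cdot> Aug I = k \<cdot> (theta_out C I 0 \<cdot> theta_in C I 0)"
        using out[of 0] k Suc 0 by (simp add: f_def theta_in_def theta_def[of _ _ _ 0])
      then have "f \<cdot> Aug I = Null C M W" unfolding zero using k Suc 0 V_Ob[OF W] by (simp add: theta_def[of _ _ _ 0])
      moreover have "(\<lambda>g. g \<cdot> Diff I 0) ` Hom C (Term I 1) W =
          {f \<in> Hom C (Term I 0) W. f \<cdot> Aug I = Null C M W}"
        using I W unfolding proper_coresolution_def by blast
      ultimately have "f \<in> (\<lambda>g. g \<cdot> Diff I 0) ` Hom C (Term I 1) W" using f 0 by simp
      then show ?thesis using 0 Suc by auto
    next
      case (Suc l)
      have "f \<cdot> Diff I l = f \<cdot> (theta_in C I m \<cdot> theta_out C I l)" using out(4)[of l] Suc by simp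
      also have "\<dots> = k \<cdot> (theta_out C I m \<cdot> theta_in C I m) \<cdot> theta_out C I l"
        using out(1-3)[of m] out(1-3)[of l] k \<open>n = Suc m\<close> Suc by (simp add: f_def)
      also have "\<dots> = Null C (Term I l) W"
        unfolding zero using out(1-3)[of m] out(1-3)[of l] k \<open>n = Suc m\<close> Suc
          Dom_closed[OF kin'(1), of m] V_Ob[OF W] by simp
      finally have "f \<cdot> Diff I l = Null C (Term I l) W" .
      moreover have "(\<lambda>g. g \<cdot> Diff I (Suc l)) ` Hom C (Term I (Suc (Suc l))) W =
          {f \<in> Hom C (Term I (Suc l)) W. f \<cdot> Diff I l = Null C (Term I l) W}"
        using I W unfolding proper_coresolution_def by blast
      ultimately have "f \<in> (\<lambda>g. g \<cdot> Diff I m) ` Hom C (Term I n) W"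
        using f Suc \<open>n = Suc m\<close> by simp
      then show ?thesis by auto
    qed
    then obtain g where g: "g \<in> Hom C (Term I n) W" "g \<cdot> Diff I m = f" by blast
    have "(g \<cdot> theta_in C I n) \<cdot> theta_out C I m = k \<cdot> theta_out C I m"
      using g out[of m] Suc by (simp add: f_def)
    then have "g \<cdot> theta_in C I n = k"
      by (rule is_epiD[OF cokernel_epi[OF out(5)[of m]]]) (use g k Suc out[of m] in auto)
    then show ?thesis using g by auto
  qed
  then show "proper_exact (theta_in C I n) (theta_out C I n)"
    using ker out by (simp add: proper_exact_def short_exact_def del: in_Hom)
  show "Cod C (theta_in C I n) = Term I n" "Dom C (theta_in C I n) = theta C M I n"
    "Cod C (theta_out C I n) = theta C M I (Suc n)"
    using out by simp_all
qed

text \<open>An arrow that kills \<open>a\<close> descends along \<open>b\<close> and then extends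
  along \<open>a'\<close>.\<close>

lemma proper_exact_Hom:
  assumes ab: "proper_exact a b" and a'b': "proper_exact a' b'" "Cod C b = Dom C a'" and W: "W \<in> V"
  shows "(\<lambda>g. g \<cdot> (a' \<cdot> b)) ` Hom C (Cod C a') W = {f \<in> Hom C (Cod C a) W. f \<cdot> a = Null C (Dom C a) W}"
proof (intro equalityI subsetI)
  note s = proper_exact_simps[OF ab] proper_exact_simps[OF a'b'(1)]
  fix f assume "f \<in> (\<lambda>g. g \<cdot> (a' \<cdot> b)) ` Hom C (Cod C a') W"
  then obtain g where g: "g \<in> Hom C (Cod C a') W" "f = g \<cdot> (a' \<cdot> b)" by auto
  have "(g \<cdot> (a' \<cdot> b)) \<cdot> a = g \<cdot> (a' \<cdot> (b \<cdot> a))" using g s(1-3,10-12) a'b'(2) by simp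
  also have "\<dots> = Null C (Dom C a) W" using g s(1-4,10-12) a'b'(2) W V_Ob by simp
  finally show "f \<in> {f \<in> Hom C (Cod C a) W. f \<cdot> a = Null C (Dom C a) W}"
    using g s(1-3,10-12) a'b'(2) by simp
next
  note s = proper_exact_simps[OF ab] proper_exact_simps[OF a'b'(1)]
  fix f assume "f \<in> {f \<in> Hom C (Cod C a) W. f \<cdot> a = Null C (Dom C a) W}"
  then obtain k where k: "k \<in> Arr C" "Dom C k = Cod C b" "Cod C k = W" "k \<cdot> b = f"
    using cokernel_desc[OF s(8), of f] by auto
  then obtain g where g: "g \<in> Arr C" "Dom C g = Cod C a'" "Cod C g = W" "g \<cdot> a' = k"
    using proper_exact_extend[OF a'b'(1), of k W] a'b'(2) W by auto
  then have "f = g \<cdot> (a' \<cdot> b)" using k s a'b'(2) comp_assoc[of b a' g] by simp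
  then show "f \<in> (\<lambda>g. g \<cdot> (a' \<cdot> b)) ` Hom C (Cod C a') W" using g by auto
qed

text \<open>The converse of \<open>theta_exact\<close>, by which a coresolution can be altered from
  some degree on.\<close>

lemma splice_proper_coresolution:
  assumes ab: "\<And>n. proper_exact (a n) (b n)" and V: "\<And>n. Cod C (a n) \<in> V"
    and b: "\<And>n. Cod C (b n) = Dom C (a (Suc n))"
  shows "proper_coresolution C V (Dom C (a 0))
    \<lparr>Term = \<lambda>n. Cod C (a n), Diff = \<lambda>n. a (Suc n) \<cdot> b n, Aug = a 0\<rparr>"
proof -
  have s: "a n \<in> Arr C" "b n \<in> Arr C" "Dom C (b n) = Cod C (a n)" "Cod C (b n) = Dom C (a (Suc n))"
    "b n \<cdot> a n = Null C (Dom C (a n)) (Cod C (b n))" "is_mono C (a n)" "is_epi C (b n)"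
    "is_kernel C (a n) (b n)" "is_cokernel C (b n) (a n)" for n
    using proper_exact_simps[OF ab[of n]] b by auto
  have d: "a (Suc n) \<cdot> b n \<in> Arr C" "Dom C (a (Suc n) \<cdot> b n) = Cod C (a n)"
    "Cod C (a (Suc n) \<cdot> b n) = Cod C (a (Suc n))" for n
    using s(1-4)[of n] s(1-4)[of "Suc n"] by auto
  have "exact_at C (a (Suc n) \<cdot> b n) (a (Suc (Suc n)) \<cdot> b (Suc n))" for n
  proof -
    let ?c = "coker C (a (Suc n) \<cdot> b n)"
    have "is_cokernel C ?c (a (Suc n) \<cdot> b n)" by (rule coker_is_cokernel) (rule d)
    then have c: "is_cokernel C ?c (a (Suc n))"
      by (rule is_cokernel_comp_epi) (use s in auto)
    note c' = cokernel_simps[OF c]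
    have k: "is_kernel C (a (Suc n)) ?c" using mono_is_kernel[OF s(6) c] .
    \<comment> \<open>\<open>image_arr\<close> is a chosen kernel of \<open>?c\<close> and may
      differ from \<open>a (Suc n)\<close>. But \<open>a (Suc n)\<close> is a kernel both of
      \<open>?c\<close> and of \<open>b (Suc n)\<close>, so these two kill the same arrows.\<close>
    have "is_kernel C (image_arr C (a (Suc n) \<cdot> b n)) (b (Suc n))"
    proof (rule is_kernel_cong)
      show "is_kernel C (image_arr C (a (Suc n) \<cdot> b n)) ?c"
        unfolding image_arr_def by (rule ker_is_kernel) (rule c')
      fix h assume h: "h \<in> Arr C" "Cod C h = Dom C ?c"
      have fact: "(\<exists>u \<in> Hom C (Dom C h) (Dom C (a (Suc n))). a (Suc n) \<cdot> u = h) \<longleftrightarrow>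
          f \<cdot> h = Null C (Dom C h) (Cod C f)" if f: "is_kernel C (a (Suc n)) f" for f
      proof
        note f' = kernel_simps[OF f]
        assume "\<exists>u \<in> Hom C (Dom C h) (Dom C (a (Suc n))). a (Suc n) \<cdot> u = h"
        then obtain u where u: "u \<in> Hom C (Dom C h) (Dom C (a (Suc n)))" "a (Suc n) \<cdot> u = h" by blast
        then show "f \<cdot> h = Null C (Dom C h) (Cod C f)"
          using comp_eq[OF f'(4), of u] f' by simp
      next
        assume "f \<cdot> h = Null C (Dom C h) (Cod C f)"
        then show "\<exists>u \<in> Hom C (Dom C h) (Dom C (a (Suc n))). a (Suc n) \<cdot> u = h"
          using kernel_lift[OF f, of h] h c' kernel_simps[OF f] by (metis in_Hom)
      qed
      show "b (Suc n) \<cdot> h = Null C (Dom C h) (Cod C (b (Suc n))) \<longleftrightarrow> ?c \<cdot> h = Null C (Dom C h) (Cod C ?c)"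
        using fact[OF k] fact[OF s(8)] by simp
    qed (use s c' in auto)
    then show ?thesis
      using is_kernel_mono_comp[OF s(6), of "b (Suc n)" "Suc (Suc n)"] s(2,4) d by (simp add: exact_at_def)
  qed
  moreover have "is_kernel C (a 0) (a (Suc 0) \<cdot> b 0)"
    using is_kernel_mono_comp[OF s(6), of "b 0" "Suc 0"] s(2,4,8) by simp
  moreover have "(\<lambda>g. g \<cdot> a 0) ` Hom C (Cod C (a 0)) W = Hom C (Dom C (a 0)) W" if W: "W \<in> V" for W
  proof (intro equalityI subsetI)
    fix f assume "f \<in> Hom C (Dom C (a 0)) W"
    then obtain k where "k \<in> Arr C" "Dom C k = Cod C (a 0)" "Cod C k = W" "k \<cdot> a 0 = f"
      using proper_exact_extend[OF ab[of 0], of f W] W by blast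
    then show "f \<in> (\<lambda>g. g \<cdot> a 0) ` Hom C (Cod C (a 0)) W" by auto
  qed (use s(1)[of 0] in auto)
  \<comment> \<open>\<open>proper_exact_Hom\<close> describes the image by arrows that kill
    \<open>a (Suc n)\<close>, a coresolution by arrows that kill the differential. As
    \<open>b n\<close> is epi, the two conditions agree.\<close>
  moreover have "{f \<in> Hom C (Cod C (a (Suc n))) W. f \<cdot> a (Suc n) = Null C (Dom C (a (Suc n))) W} =
      {f \<in> Hom C (Cod C (a (Suc n))) W. f \<cdot> (a (Suc n) \<cdot> b n) = Null C (Cod C (a n)) W}"
    if W: "W \<in> V" for W n
  proof -
    have "f \<cdot> a (Suc n) = Null C (Dom C (a (Suc n))) W \<longleftrightarrow>
        f \<cdot> (a (Suc n) \<cdot> b n) = Null C (Cod C (a n)) W" if "f \<in> Hom C (Cod C (a (Suc n))) W" for f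
    proof
      assume "f \<cdot> a (Suc n) = Null C (Dom C (a (Suc n))) W"
      then show "f \<cdot> (a (Suc n) \<cdot> b n) = Null C (Cod C (a n)) W"
        using comp_eq[of f "a (Suc n)" _ "b n"] that s(1-4) V_Ob[OF W] by simp
    next
      assume "f \<cdot> (a (Suc n) \<cdot> b n) = Null C (Cod C (a n)) W"
      then show "f \<cdot> a (Suc n) = Null C (Dom C (a (Suc n))) W"
        using epi_comp_Null[OF s(7)[of n], of "f \<cdot> a (Suc n)"] that s(1-4)[of n] s(1-4)[of "Suc n"] by simp
    qed
    then show ?thesis by blast
  qed
  moreover have "a (Suc n) \<cdot> b n \<in> Hom C (Cod C (a n)) (Cod C (a (Suc n)))"
    "a 0 \<in> Hom C (Dom C (a 0)) (Cod C (a 0))" for n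
    using d s by simp_all
  ultimately show ?thesis
    using V proper_exact_Hom[OF ab ab b] by (simp add: proper_coresolution_def del: in_Hom)
qed

text \<open>The last piece of a truncated coresolution; with \<open>A\<close> zero as well it gives
  the tail.\<close>

lemma proper_exact_Ide:
  assumes A: "A \<in> Ob C" and Z: "is_zero_object C Z"
  shows "proper_exact (Ide C A) (Null C A Z)"
proof -
  note Z' = zero_object_Ob[OF Z]
  have "is_kernel C (Ide C A) (Null C A Z)"
  proof (rule is_kernelI)
    show "is_mono C (Ide C A)" by (rule is_monoI) (use A in auto)
  qed (use A Z' in auto)
  moreover have "is_cokernel C (Null C A Z) (Ide C A)"
  proof (rule is_cokernelI)
    show "is_epi C (Null C A Z)"
      by (rule is_epiI) (use A Z' zero_object_Dom[OF Z] in auto)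
    fix h assume h: "h \<in> Arr C" "Dom C h = Cod C (Ide C A)"
      "h \<cdot> Ide C A = Null C (Dom C (Ide C A)) (Cod C h)"
    then show "\<exists>u \<in> Hom C (Cod C (Null C A Z)) (Cod C h). u \<cdot> Null C A Z = h"
      using A Z' by (intro bexI[of _ "Null C Z (Cod C h)"]) auto
  qed (use A Z' in auto)
  ultimately show ?thesis using A by (auto simp: proper_exact_def short_exact_def)
qed

section \<open>Finite injective dimension relative to V\<close>

lemma theta_in_V_imp_V_id_finite:
  assumes I: "proper_coresolution C V M I" and l: "theta C M I l \<in> V"
  shows "V_id C V M < \<infinity>"
proof -
  obtain Z where Z: "Z \<in> V" "is_zero_object C Z" using zero_in_V .
  note Z' = zero_object_Ob[OF Z(2)] and L = V_Ob[OF l]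
  \<comment> \<open>Degree \<open>l\<close> now holds the cosyzygy itself, and all later degrees are
    zero. For \<open>l\<close> equal to 0 the augmentation becomes the identity of
    \<open>M\<close>.\<close>
  define a where "a n = (if n < l then theta_in C I n else if n = l then Ide C (theta C M I l)
    else Ide C Z)" for n
  define b where "b n = (if n < l then theta_out C I n else if n = l then Null C (theta C M I l) Z
    else Null C Z Z)" for n
  define J where "J = \<lparr>Term = \<lambda>n. Cod C (a n), Diff = \<lambda>n. a (Suc n) \<cdot> b n, Aug = a 0\<rparr>"
  have "Term I n \<in> V" for n using I by (simp add: proper_coresolution_def)
  moreover have "Dom C (a 0) = M" using theta_exact(3)[OF I, of 0] L by (auto simp: a_def theta_def)
  moreover have "Cod C (b n) = Dom C (a (Suc n))" for n
    using theta_exact(3,4)[OF I] L Z' by (auto simp: a_def b_def less_Suc_eq)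
  moreover have "proper_exact (a n) (b n)" for n
    using theta_exact(1)[OF I] proper_exact_Ide L Z' Z by (simp add: a_def b_def)
  ultimately have "proper_coresolution C V M J"
    using splice_proper_coresolution[of a b] theta_exact(2)[OF I] l L Z Z' unfolding J_def
    by (auto simp: a_def)
  then have "V_id C V M \<le> (SUP n \<in> {n. \<not> is_zero_object C (Term J n)}. ereal (real n))"
    unfolding V_id_def by (intro INF_lower) auto
  also have "\<dots> \<le> ereal (real l)"
  proof (rule SUP_least)
    fix n assume n: "n \<in> {n. \<not> is_zero_object C (Term J n)}"
    then have "\<not> l < n" using Z Z' by (auto simp: J_def a_def)
    then show "ereal (real n) \<le> ereal (real l)" by simp
  qed
  finally show ?thesis by (auto intro: le_less_trans)
qed

lemma V_id_finiteD:
  assumes "V_id C V N < \<infinity>"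
  obtains I l where "proper_coresolution C V N I" "\<And>n. n \<ge> l \<Longrightarrow> is_zero_object C (Term I n)"
proof -
  obtain I where I: "proper_coresolution C V N I"
    "(SUP n \<in> {n. \<not> is_zero_object C (Term I n)}. ereal (real n)) < \<infinity>" (is "?S < _")
    using assms unfolding V_id_def INF_less_iff by auto
  \<comment> \<open>The bound is taken strictly above the supremum, so degree \<open>l\<close>
    itself is already zero. The value minus infinity, when all terms are zero, is covered
    too.\<close>
  then obtain l where l: "?S < ereal (real l)" using less_PInf_Ex_of_nat[of ?S] by auto
  have "is_zero_object C (Term I n)" if "n \<ge> l" for n
  proof (rule ccontr)
    assume "\<not> is_zero_object C (Term I n)"
    then have "ereal (real n) \<le> ?S" by (intro SUP_upper) auto
    then have "ereal (real n) < ereal (real l)" using l by (rule le_less_trans)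
    then show False using that by simp
  qed
  then show ?thesis using that I by blast
qed

text \<open>When \<open>b a - 1 = h k\<close> with \<open>k\<close> extended to \<open>k'\<close> along \<open>i\<close>, the arrow
  \<open>b\<^sub>1 a\<^sub>1 - 1 - i h k'\<close> vanishes on \<open>Dom C i\<close>, and the arrow \<open>Cod C p \<rightarrow> Cod C i\<close> that it
  induces lifts \<open>b\<^sub>2 a\<^sub>2 - 1\<close>.\<close>

lemma stable_retract_step:
  assumes e: "proper_exact i p" "Cod C i \<in> V" and e': "proper_exact i' p'" "Cod C i' \<in> V"
    and a: "a \<in> Hom C (Dom C i) (Dom C i')" and b: "b \<in> Hom C (Dom C i') (Dom C i)"
    and ab: "sub (b \<cdot> a) (Ide C (Dom C i)) \<in> factoring C V (Dom C i) (Dom C i)"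
  obtains a2 b2 where "a2 \<in> Hom C (Cod C p) (Cod C p')" "b2 \<in> Hom C (Cod C p') (Cod C p)"
    "sub (b2 \<cdot> a2) (Ide C (Cod C p)) \<in> factoring C V (Cod C p) (Cod C p)"
proof -
  note s = proper_exact_simps[OF e(1)] and s' = proper_exact_simps[OF e'(1)]
  obtain a1 a2 where a1: "a1 \<in> Hom C (Cod C i) (Cod C i')" "a2 \<in> Hom C (Cod C p) (Cod C p')"
    "a1 \<cdot> i = i' \<cdot> a" "p' \<cdot> a1 = a2 \<cdot> p"
    using proper_exact_morphism[OF e(1) s'(9) e'(2) a] .
  obtain b1 b2 where b1: "b1 \<in> Hom C (Cod C i') (Cod C i)" "b2 \<in> Hom C (Cod C p') (Cod C p)"
    "b1 \<cdot> i' = i \<cdot> b" "p \<cdot> b1 = b2 \<cdot> p'"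
    using proper_exact_morphism[OF e'(1) s(9) e(2) b] .
  obtain W k h where W: "W \<in> V" "k \<in> Hom C (Dom C i) W" "h \<in> Hom C W (Dom C i)"
    "sub (b \<cdot> a) (Ide C (Dom C i)) = h \<cdot> k"
    using ab by (rule factoringD)
  obtain k' where k': "k' \<in> Arr C" "Dom C k' = Cod C i" "Cod C k' = W" "k' \<cdot> i = k"
    using proper_exact_extend[OF e(1) W(2,1)] .
  define d where "d = sub (sub (b1 \<cdot> a1) (Ide C (Cod C i))) (i \<cdot> (h \<cdot> k'))"
  have d: "d \<in> Arr C" "Dom C d = Cod C i" "Cod C d = Cod C i"
    using a1(1,2) b1(1,2) W(1-3) k' s(1-3) by (auto simp: d_def)
  have "b1 \<cdot> (a1 \<cdot> i) = i \<cdot> (b \<cdot> a)"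
    using a1(1-3) b1(1,2) a b s(1-3) s'(1-3) comp_square[OF b1(3), of a] by simp
  then have "d \<cdot> i = sub (sub (i \<cdot> (b \<cdot> a)) i) (i \<cdot> (h \<cdot> k))"
    using a1(1,2) b1(1,2) W(1-3) k' s(1-3) by (simp add: d_def)
  also have "\<dots> = i \<cdot> sub (sub (b \<cdot> a) (Ide C (Dom C i))) (h \<cdot> k)"
    using a b W(1-3) s(1-3) by simp
  also have "\<dots> = Null C (Dom C i) (Cod C i)" unfolding W(4) using W(1-3) s(1-3) by simp
  finally obtain t where t: "t \<in> Arr C" "Dom C t = Cod C p" "Cod C t = Cod C i" "t \<cdot> p = d"
    using cokernel_desc[OF s(8), of d] d by auto
  have "p \<cdot> (b1 \<cdot> a1) = b2 \<cdot> (p' \<cdot> a1)"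
    by (rule comp_square[OF b1(4)]) (use a1(1,2) b1(1,2) s(1-3) s'(1-3) in auto)
  then have "p \<cdot> (b1 \<cdot> a1) = b2 \<cdot> (a2 \<cdot> p)" unfolding a1(4) .
  then have "sub (b2 \<cdot> a2) (Ide C (Cod C p)) \<cdot> p = p \<cdot> d"
    using a1(1,2) b1(1,2) W(1-3) k' s(1-3) s'(1-3) comp_eq[OF s(4), of "h \<cdot> k'"] by (simp add: d_def)
  also have "\<dots> = (p \<cdot> t) \<cdot> p" using t s(1-3) by simp
  finally have "sub (b2 \<cdot> a2) (Ide C (Cod C p)) = p \<cdot> t"
    by (rule is_epiD[OF s(6)]) (use a1(1,2) b1(1,2) t s(1-3) in auto)
  then have "sub (b2 \<cdot> a2) (Ide C (Cod C p)) \<in> factoring C V (Cod C p) (Cod C p)"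
    using t s(1-3) e(2) by (intro factoringI[of t _ "Cod C i" p]) auto
  then show ?thesis using that a1 b1 by blast
qed

lemma Ide_theta_factoring:
  assumes N: "V_id C V N < \<infinity>" and J: "proper_coresolution C V N J"
  obtains l where "\<And>n. n \<ge> l \<Longrightarrow> Ide C (theta C N J n) \<in> factoring C V (theta C N J n) (theta C N J n)"
proof -
  obtain I l where I: "proper_coresolution C V N I" and l: "\<And>n. n \<ge> l \<Longrightarrow> is_zero_object C (Term I n)"
    using V_id_finiteD[OF N] by blast
  have V: "Term I n \<in> V" "Term J n \<in> V" for n using I J by (auto simp: proper_coresolution_def)
  note tI = theta_exact[OF I] and tJ = theta_exact[OF J]
  \<comment> \<open>The arrows go from the cosyzygy of the given coresolution to that of the finite
    one and back. In degree 0 both objects are \<open>N\<close>, and identities serve.\<close>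
  have retract: "\<exists>a b. a \<in> Hom C (theta C N J n) (theta C N I n) \<and>
      b \<in> Hom C (theta C N I n) (theta C N J n) \<and>
      sub (b \<cdot> a) (Ide C (theta C N J n)) \<in> factoring C V (theta C N J n) (theta C N J n)" for n
  proof (induction n)
    case 0
    have "N \<in> Ob C" using J Dom_closed[of "Aug J"] by (auto simp: proper_coresolution_def)
    then show ?case using factoring_Null[of N N]
      by (auto simp: theta_def intro!: exI[of _ "Ide C N"])
  next
    case (Suc n)
    then obtain a b where "a \<in> Hom C (Dom C (theta_in C J n)) (Dom C (theta_in C I n))"
      "b \<in> Hom C (Dom C (theta_in C I n)) (Dom C (theta_in C J n))"
      "sub (b \<cdot> a) (Ide C (Dom C (theta_in C J n))) \<in>
        factoring C V (Dom C (theta_in C J n)) (Dom C (theta_in C J n))"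
      unfolding tI tJ by blast
    then show ?case
      using stable_retract_step[OF tJ(1)[of n] _ tI(1)[of n], of a b] V unfolding tI tJ by metis
  qed
  have "Ide C (theta C N J n) \<in> factoring C V (theta C N J n) (theta C N J n)" if "n \<ge> l" for n
  proof -
    obtain a b where a: "a \<in> Hom C (theta C N J n) (theta C N I n)"
      and b: "b \<in> Hom C (theta C N I n) (theta C N J n)"
      and ab: "sub (b \<cdot> a) (Ide C (theta C N J n)) \<in> factoring C V (theta C N J n) (theta C N J n)"
      using retract by blast
    have T: "theta C N J n \<in> Ob C" using a Dom_closed[of a] by simp
    note s = proper_exact_simps[OF tI(1)[of n]]
    \<comment> \<open>The cosyzygy of the finite coresolution embeds into a zero term, so
      \<open>a\<close> is zero. What factors through V is then minus the identity.\<close>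
    have "theta_in C I n \<cdot> a = Null C (Dom C a) (Cod C (theta_in C I n))"
      using zero_object_Cod[OF l[OF that], of "theta_in C I n \<cdot> a"] a s tI(2-4)[of n] by simp
    then have "a = Null C (Dom C a) (Cod C a)"
      by (rule mono_comp_Null[OF s(5)]) (use a tI(3)[of n] in auto)
    then have "b \<cdot> a = b \<cdot> Null C (theta C N J n) (theta C N I n)" using a by simp
    also have "\<dots> = Null C (theta C N J n) (theta C N J n)" using T b by (subst comp_Null) auto
    finally have "neg (Ide C (theta C N J n)) \<in> factoring C V (theta C N J n) (theta C N J n)"
      using ab T by auto
    then have "neg (neg (Ide C (theta C N J n))) \<in> factoring C V (theta C N J n) (theta C N J n)"
      by (rule factoring_neg)
    then show ?thesis using T by simp
  qed
  then show ?thesis using that by blast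
qed

text \<open>A retract must be completed to a biproduct before closure under summands applies. The
  complement is the kernel \<open>k\<close> of \<open>h\<close>: the arrow
  \<open>1 - g \<cdot> h\<close> is killed by \<open>h\<close>, and its lift along \<open>k\<close>
  is the second projection.\<close>

lemma Ide_factoring_imp_in_V:
  assumes V: "closed_under_summands C V" and A: "Ide C A \<in> factoring C V A A"
  shows "A \<in> V"
proof -
  obtain W g h where W: "W \<in> V" "g \<in> Hom C A W" "h \<in> Hom C W A" "Ide C A = h \<cdot> g"
    using A by (rule factoringD)
  have A': "A \<in> Ob C" "W \<in> Ob C" using W(2) by auto
  obtain k where k: "is_kernel C k h" using kernel_exists W(3) by auto
  note k' = kernel_simps[OF k]
  define d where "d = sub (Ide C W) (g \<cdot> h)"
  have d: "d \<in> Arr C" "Dom C d = W" "Cod C d = W" using W A' by (auto simp: d_def)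
  have "h \<cdot> d = Null C W A"
    using W(2,3) A' comp_eq[OF W(4)[symmetric], of h] by (simp add: d_def)
  then obtain q where q: "q \<in> Arr C" "Dom C q = W" "Cod C q = Dom C k" "k \<cdot> q = d"
    using kernel_lift[OF k, of d] d W by auto
  have "k \<cdot> (q \<cdot> k) = d \<cdot> k" using comp_eq[OF q(4), of k] q k' W by simp
  also have "\<dots> = k \<cdot> Ide C (Dom C k)" using W(2,3) A' k' by (simp add: d_def)
  finally have qk: "q \<cdot> k = Ide C (Dom C k)"
    by (rule is_monoD[OF kernel_mono[OF k]]) (use q k' W in auto)
  have "k \<cdot> (q \<cdot> g) = d \<cdot> g" using comp_eq[OF q(4), of g] q k' W by simp
  also have "\<dots> = Null C A W" using W A' by (simp add: d_def flip: W(4))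
  finally have qg: "q \<cdot> g = Null C A (Dom C k)"
    using mono_comp_Null[OF kernel_mono[OF k], of "q \<cdot> g"] q k' W by simp
  have "Plus C (g \<cdot> h) (k \<cdot> q) = Plus C d (g \<cdot> h)"
    unfolding q(4) using W(2,3) d by (intro Plus_commute) auto
  also have "\<dots> = Ide C W" using W A' by (simp add: d_def)
  finally have "is_biproduct C A (Dom C k) W g k h q"
    using W k' q qk qg by (simp add: is_biproduct_def)
  then show ?thesis using V W A' k' Dom_closed[OF k'(2)] unfolding closed_under_summands_def by blast
qed

text \<open>Composing with the identity of either end makes every arrow factor through V.\<close>

lemma Hom_bar_trivial:
  assumes "Ide C A \<in> factoring C V A A \<or> Ide C B \<in> factoring C V B B" "A \<in> Ob C" "B \<in> Ob C"
  shows "carrier (Hom_bar C V A B) = {\<one>\<^bsub>Hom_bar C V A B\<^esub>}"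
proof -
  have "f \<in> factoring C V A B" if "f \<in> Hom C A B" for f
    using assms(1) factoring_comp_left[of "Ide C A" A A f B] factoring_comp_right[of "Ide C B" B B f A]
      that by auto
  then have "Hom_proj C V A B f = \<one>\<^bsub>Hom_bar C V A B\<^esub>" if "f \<in> Hom C A B" for f
    using Hom_proj_eq_iff[of f A B "Null C A B"] that assms by (simp add: one_Hom_bar)
  moreover have "Null C A B \<in> Hom C A B" using assms by simp
  ultimately show ?thesis unfolding carrier_Hom_bar by blast
qed

end

section \<open>Colimits and complete cohomology\<close>

lemma fold_transition_closed:
  assumes "\<And>i x. k \<le> i \<Longrightarrow> x \<in> carrier (G i) \<Longrightarrow> t i x \<in> carrier (G (Suc i))"
    and "k \<le> i" "i \<le> j" "x \<in> carrier (G i)"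
  shows "fold t [i..<j] x \<in> carrier (G j)"
  using assms(3)
proof (induction j rule: dec_induct)
  case (step j)
  then show ?case using assms(1)[of j] assms(2) by simp
qed (use assms in simp)

text \<open>Any two elements can be moved to a common index beyond \<open>l\<close>, where they
  coincide. So \<open>colim_rel\<close> is the total relation and there is a single class.\<close>

lemma trivial_group_colim:
  assumes grp: "\<And>i. k \<le> i \<Longrightarrow> group (G i)"
    and t: "\<And>i x. k \<le> i \<Longrightarrow> x \<in> carrier (G i) \<Longrightarrow> t i x \<in> carrier (G (Suc i))"
    and triv: "\<And>i. l \<le> i \<Longrightarrow> k \<le> i \<Longrightarrow> carrier (G i) = {\<one>\<^bsub>G i\<^esub>}"
  shows "trivial_group (colim k G t)"
proof -
  define S where "S = (SIGMA i:{k..}. carrier (G i))"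
  have one: "(k, \<one>\<^bsub>G k\<^esub>) \<in> S" using grp[of k] by (auto simp: S_def group.is_monoid monoid.one_closed)
  have rel: "colim_rel k G t = S \<times> S"
  proof -
    have "\<exists>m. i \<le> m \<and> j \<le> m \<and> fold t [i..<m] x = fold t [j..<m] y"
      if "k \<le> i" "k \<le> j" "x \<in> carrier (G i)" "y \<in> carrier (G j)" for i j x y
    proof (intro exI conjI)
      let ?m = "max l (max i j)"
      have "fold t [i..<?m] x \<in> carrier (G ?m)" "fold t [j..<?m] y \<in> carrier (G ?m)"
        using fold_transition_closed[of k G t, OF t] that by auto
      then show "fold t [i..<?m] x = fold t [j..<?m] y"
        using triv[of ?m] that by auto
    qed auto
    then show ?thesis unfolding colim_rel_def S_def by auto
  qed
  have cls: "(S \<times> S) `` {z} = S" if "z \<in> S" for z using that by auto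
  have "S // (S \<times> S) = {S}" using one cls by (auto simp: quotient_def)
  then have carr: "carrier (colim k G t) = {S}" by (simp add: colim_def rel S_def)
  have o: "\<one>\<^bsub>colim k G t\<^esub> = S" using cls[OF one] by (simp add: colim_def rel)
  have "(max i j, fold t [i..<max i j] x \<otimes>\<^bsub>G (max i j)\<^esub> fold t [j..<max i j] y) \<in> S"
    if "(i, x) \<in> S" "(j, y) \<in> S" for i x j y
  proof -
    have "fold t [i..<max i j] x \<in> carrier (G (max i j))" "fold t [j..<max i j] y \<in> carrier (G (max i j))"
      using fold_transition_closed[of k G t, OF t] that by (auto simp: S_def)
    then show ?thesis
      using that monoid.m_closed[OF group.is_monoid[OF grp[of "max i j"]]] by (auto simp: S_def)
  qed
  then have "(\<Union>(i, x) \<in> S. \<Union>(j, y) \<in> S. (S \<times> S) ``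
      {(max i j, fold t [i..<max i j] x \<otimes>\<^bsub>G (max i j)\<^esub> fold t [j..<max i j] y)}) =
      (\<Union>z \<in> S. \<Union>w \<in> S. S)"
    using cls by (intro SUP_cong refl) (auto split: prod.split)
  then have m: "S \<otimes>\<^bsub>colim k G t\<^esub> S = S" using one by (auto simp: colim_def rel)
  have "group (colim k G t)"
    by (rule groupI) (auto simp: carr o m)
  then show ?thesis by (simp add: trivial_group_def carr o)
qed

lemma trivial_group_colimD:
  assumes "trivial_group (colim k G t)" "x \<in> carrier (G k)" "\<one>\<^bsub>G k\<^esub> \<in> carrier (G k)"
  obtains l where "k \<le> l" "fold t [k..<l] x = fold t [k..<l] \<one>\<^bsub>G k\<^esub>"
proof -
  have "colim_rel k G t `` {(k, x)} \<in> carrier (colim k G t)"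
    using assms(2) by (auto simp: colim_def quotient_def)
  then have "colim_rel k G t `` {(k, x)} = \<one>\<^bsub>colim k G t\<^esub>"
    using assms(1) by (simp add: trivial_group_def)
  then have "colim_rel k G t `` {(k, x)} = colim_rel k G t `` {(k, \<one>\<^bsub>G k\<^esub>)}"
    by (simp add: colim_def)
  \<comment> \<open>The second class contains its own representative, so equality of the classes
    puts that representative into the class of \<open>x\<close>.\<close>
  moreover have "(k, \<one>\<^bsub>G k\<^esub>) \<in> colim_rel k G t `` {(k, \<one>\<^bsub>G k\<^esub>)}"
    using assms(3) by (auto simp: colim_rel_def)
  ultimately have "((k, x), (k, \<one>\<^bsub>G k\<^esub>)) \<in> colim_rel k G t" by auto
  then show ?thesis using that by (auto simp: colim_rel_def)
qed

text \<open>From the starting index on, \<open>int i + n\<close> is nonnegative, so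
  \<open>nat\<close> does not truncate and the second index advances in step with the first.\<close>

lemma nat_Suc_shift: "nat (- n) \<le> i \<Longrightarrow> nat (int (Suc i) + n) = Suc (nat (int i + n))"
  by linarith

section \<open>The direct systems of complete cohomology\<close>

locale abelian_with_coresolutions = abelian_with_subcategory +
  fixes R :: "'a \<Rightarrow> ('a, 'b) coresolution"
  assumes R: "M \<in> Ob C \<Longrightarrow> proper_coresolution C V M (R M)"
begin

lemma theta_Ob: "M \<in> Ob C \<Longrightarrow> theta C M (R M) i \<in> Ob C"
  using theta_exact(1,3)[OF R, of M i] proper_exact_simps(1) Dom_closed by metis

lemma R_in_V: "M \<in> Ob C \<Longrightarrow> Term (R M) i \<in> V"
  using R by (simp add: proper_coresolution_def)

text \<open>The disjunction lets one argument cover vanishing in either variable.\<close>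

lemma complete_Ext_trivial:
  assumes M: "M \<in> Ob C" and N: "N \<in> Ob C"
    and l: "\<And>i. i \<ge> l \<Longrightarrow> i \<ge> nat (- n) \<Longrightarrow>
      Ide C (theta C M (R M) i) \<in> factoring C V (theta C M (R M) i) (theta C M (R M) i) \<or>
      Ide C (theta C N (R N) (nat (int i + n))) \<in>
        factoring C V (theta C N (R N) (nat (int i + n))) (theta C N (R N) (nat (int i + n)))"
  shows "trivial_group (complete_Ext C V R n M N)"
  unfolding complete_Ext_def
proof (rule trivial_group_colim)
  fix i
  show "group (Hom_bar C V (theta C M (R M) i) (theta C N (R N) (nat (int i + n))))"
    using Hom_bar_group theta_Ob M N by simp
  show "carrier (Hom_bar C V (theta C M (R M) i) (theta C N (R N) (nat (int i + n)))) =
      {\<one>\<^bsub>Hom_bar C V (theta C M (R M) i) (theta C N (R N) (nat (int i + n)))\<^esub>}"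
    if "l \<le> i" "nat (- n) \<le> i"
    using Hom_bar_trivial l that theta_Ob M N by simp
  fix x
  assume i: "nat (- n) \<le> i"
    and x: "x \<in> carrier (Hom_bar C V (theta C M (R M) i) (theta C N (R N) (nat (int i + n))))"
  show "Delta C V (theta_ext C (R M) i) (theta_ext C (R N) (nat (int i + n))) x \<in>
      carrier (Hom_bar C V (theta C M (R M) (Suc i)) (theta C N (R N) (nat (int (Suc i) + n))))"
    using Delta_closed[OF theta_exact(1)[OF R[OF M]] proper_exact_simps(9)[OF theta_exact(1)[OF R[OF N]]],
        of "nat (int i + n)" x i] x R_in_V[OF N]
    unfolding theta_ext_def nat_Suc_shift[OF i] theta_exact[OF R[OF M]] theta_exact[OF R[OF N]] by blast
qed

text \<open>For \<open>n\<close> equal to 0 the system starts at index 0 with equal arguments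
  throughout, so the identity of \<open>N\<close> defines an element of the colimit that can be
  followed through every stage.\<close>

lemma complete_Ext_self_trivial_imp:
  assumes N: "N \<in> Ob C" and triv: "trivial_group (complete_Ext C V R 0 N N)"
  obtains l where "Ide C (theta C N (R N) l) \<in> factoring C V (theta C N (R N) l) (theta C N (R N) l)"
proof -
  define T where "T = theta C N (R N)"
  define e where "e = theta_ext C (R N)"
  define G where "G i = Hom_bar C V (T i) (T i)" for i
  define t where "t i = Delta C V (e i) (e i)" for i
  have T: "T i \<in> Ob C" for i using theta_Ob N by (simp add: T_def)
  note th = theta_exact[OF R[OF N], folded T_def]
  have V: "Cod C (theta_in C (R N) i) \<in> V" for i using th(2) R_in_V[OF N] by simp
  let ?x = "Hom_proj C V (T 0) (T 0) (Ide C (T 0))"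
  have "complete_Ext C V R 0 N N = colim 0 G t"
    by (simp add: complete_Ext_def G_def[abs_def] t_def[abs_def] T_def e_def)
  moreover have "?x \<in> carrier (G 0)" using T by (simp add: G_def carrier_Hom_bar)
  moreover have "\<one>\<^bsub>G 0\<^esub> \<in> carrier (G 0)"
    using Hom_bar_group[OF T T] by (simp add: G_def group.is_monoid monoid.one_closed)
  ultimately obtain l where l: "fold t [0..<l] ?x = fold t [0..<l] \<one>\<^bsub>G 0\<^esub>"
    using trivial_group_colimD[of 0 G t ?x] triv by metis
  have "fold t [0..<i] ?x = Hom_proj C V (T i) (T i) (Ide C (T i))" for i
  proof (induction i)
    case (Suc i)
    then show ?case using Delta_Ide[OF th(1) V, of i] th by (simp add: t_def e_def theta_ext_def)
  qed simp
  \<comment> \<open>Triviality of the colimit only says that the identity and zero have equal images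
    at some stage, so the zero class is followed as well.\<close>
  moreover have "fold t [0..<i] \<one>\<^bsub>G 0\<^esub> = \<one>\<^bsub>G i\<^esub>" for i
  proof (induction i)
    case (Suc i)
    then show ?case using Delta_one[OF th(1) proper_exact_simps(9)[OF th(1)] V, of i] th
      by (simp add: t_def e_def theta_ext_def G_def)
  qed simp
  ultimately have "Hom_proj C V (T l) (T l) (Ide C (T l)) =
      Hom_proj C V (T l) (T l) (Null C (T l) (T l))"
    using l T by (simp add: G_def one_Hom_bar)
  then have "Ide C (T l) \<in> factoring C V (T l) (T l)"
    using Hom_proj_eq_iff[of "Ide C (T l)" "T l" "T l" "Null C (T l) (T l)"] T by simp
  then show ?thesis using that by (simp add: T_def)
qed

end

theorem theorem3:
  fixes C :: "('o, 'm) cat" and V :: "'o set" and R :: "'o \<Rightarrow> ('o, 'm) coresolution" and N :: 'o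
  assumes "abelian_category C"
    and "additive_subcategory C V"
    and "special_preenveloping C V"
    and "closed_under_summands C V"
    and "\<forall>M \<in> Ob C. special_proper_coresolution C V M (R M)"
    and "N \<in> Ob C"
  shows "(V_id C V N < \<infinity> \<longleftrightarrow>
      (\<forall>n. \<forall>M \<in> Ob C. trivial_group (complete_Ext C V R n N M) \<and>
        trivial_group (complete_Ext C V R n M N))) \<and>
    ((\<forall>n. \<forall>M \<in> Ob C. trivial_group (complete_Ext C V R n N M) \<and>
        trivial_group (complete_Ext C V R n M N)) \<longleftrightarrow>
      trivial_group (complete_Ext C V R 0 N N))"
proof -
  interpret abelian_category C by fact
  interpret abelian_with_coresolutions C V R
    using assms by unfold_locales (auto simp: special_proper_coresolution_def)
  note RN = R[OF \<open>N \<in> Ob C\<close>]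
  have i_ii: "trivial_group (complete_Ext C V R n N M) \<and> trivial_group (complete_Ext C V R n M N)"
    if fin: "V_id C V N < \<infinity>" and M: "M \<in> Ob C" for n M
  proof -
    obtain l where l: "\<And>i. i \<ge> l \<Longrightarrow>
        Ide C (theta C N (R N) i) \<in> factoring C V (theta C N (R N) i) (theta C N (R N) i)"
      using Ide_theta_factoring[OF fin RN] by blast
    show ?thesis
    proof
      show "trivial_group (complete_Ext C V R n N M)"
        by (rule complete_Ext_trivial[OF \<open>N \<in> Ob C\<close> M, of l]) (use l in blast)
      \<comment> \<open>The cosyzygies of \<open>N\<close> now carry the index \<open>i + n\<close>,
        so for negative \<open>n\<close> the bound is raised by \<open>- n\<close>.\<close>
      have "l \<le> nat (int i + n)" if "l + nat (- n) \<le> i" for i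
        using that by linarith
      then show "trivial_group (complete_Ext C V R n M N)"
        by (intro complete_Ext_trivial[OF M \<open>N \<in> Ob C\<close>, of "l + nat (- n)"]) (use l in blast)
    qed
  qed
  have iii_i: "V_id C V N < \<infinity>" if triv: "trivial_group (complete_Ext C V R 0 N N)"
  proof -
    obtain l where "Ide C (theta C N (R N) l) \<in> factoring C V (theta C N (R N) l) (theta C N (R N) l)"
      using complete_Ext_self_trivial_imp[OF \<open>N \<in> Ob C\<close> triv] .
    then have "theta C N (R N) l \<in> V" by (rule Ide_factoring_imp_in_V[OF assms(4)])
    then show ?thesis by (rule theta_in_V_imp_V_id_finite[OF RN])
  qed
  \<comment> \<open>Specialising (ii) to \<open>M = N\<close> and degree 0 closes the cycle.\<close>
  show ?thesis using i_ii iii_i \<open>N \<in> Ob C\<close> by blast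
qed

end
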